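(* Let $\Omega\subset\mathbb{R}^2$ be a bounded polygonal domain and let $\{\mathcal{T}_h\}$ be a quasi-uniform family of triangulations of $\Omega$ with characteristic element diameter $h>0$. Let $K$ and $\bar K_{\mathrm{ES}}$ be the stiffness matrices on $V_h$ of the standard finite element method and of the edge-based smoothed finite element method (ES-FEM), respectively, as defined in the context. Then there exists a positive constant $C$, independent of the mesh size $h$, such that for any preconditioner $M^{-1}$ for $K$ (a symmetric positive definite matrix on the degrees of freedom of $V_h$), $$\kappa(M^{-1}\bar K_{\mathrm{ES}})\le C\,\kappa(M^{-1}K).$$
   Context: Triangulations are conforming; quasi-uniform means shape-regular with all element diameters comparable to $h$, with constants independent of $h$. $\mathcal{P}_n(\omega)$ is the set of polynomials of degree at most $n$ on $\omega$. $V_h=\{v\in H_0^1(\Omega): v|_e\in\mathcal{P}_1(e)\ \forall e\in\mathcal{T}_h\}$. Functions in $V_h$ are identified with their vectors of nodal degrees of freedom. Standard stiffness matrix: $u^TKv=\int_\Omega\nabla u\cdot\nabla v\,d\Omega$ for $u,v\in V_h$. ES-FEM: each element $e\in\mathcal{T}_h$ is divided into three triangles by joining its barycenter to its vertices, so each of these triangles corresponds to one edge of $e$. For each edge of $\mathcal{T}_h$, the associated smoothing domain $s$ is the union of the sub-triangles corresponding to that edge (two sub-triangles for an interior edge; one for a boundary edge). For $u\in V_h$, the smoothed gradient $\bar\nabla_{\mathrm{ES}}u$ is the piecewise constant vector field which, on the smoothing domain of an edge shared by elements $e^{(1)},e^{(2)}$, equals $$\frac{|e^{(1)}|\,\nabla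 u|_{e^{(1)}}+|e^{(2)}|\,\nabla u|_{e^{(2)}}}{|e^{(1)}|+|e^{(2)}|},$$ and which, on the smoothing domain of a boundary edge of an element $e$, equals $\nabla u|_e$. Here $|\cdot|$ denotes area. The ES-FEM stiffness matrix is given by $u^T\bar K_{\mathrm{ES}}v=\int_\Omega\bar\nabla_{\mathrm{ES}}u\cdot\bar\nabla_{\mathrm{ES}}v\,d\Omega$ for $u,v\in V_h$. Condition number: $\kappa(A)=\lambda_{\max}(A)/\lambda_{\min}(A)$, the ratio of the maximum and minimum eigenvalues of $A$; for $A=M^{-1}B$ with $M,B$ symmetric positive definite the eigenvalues are real and positive. *)

theory Defs
  imports "HOL-Analysis.Analysis" "Jordan_Normal_Form.Spectral_Radius"
begin

section \<open>Polygonal domains and triangulations\<close>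

text \<open>
  The condition that \<open>\<Omega>\<close> is the interior of its closure says that the domain lies on one side
  of its boundary: slits and removed points are excluded. Holes are allowed.
\<close>

definition polygonal_domain :: "(real^2) set \<Rightarrow> bool" where
  "polygonal_domain \<Omega> \<longleftrightarrow>
     open \<Omega> \<and> connected \<Omega> \<and> \<Omega> \<noteq> {} \<and> bounded \<Omega> \<and> \<Omega> = interior (closure \<Omega>) \<and>
     (\<exists>S. finite S \<and> frontier \<Omega> = (\<Union>(a, b)\<in>S. closed_segment a b))"

text \<open>
  The elements are closed nondegenerate triangles. Conformity (two elements meet in a common
  face, possibly empty) is part of the library notion \<^const>\<open>triangulation\<close>.
\<close>

definition mesh_of :: "(real^2) set \<Rightarrow> (real^2) set set \<Rightarrow> bool" where
  "mesh_of \<Omega> \<T> \<longleftrightarrow> triangulation \<T> \<and> (\<forall>e\<in>\<T>. 2 simplex e) \<and> \<Union>\<T> = closure \<Omega>"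

definition inball_diameter :: "(real^2) set \<Rightarrow> real" where
  "inball_diameter e = Sup {2 * r | r. 0 \<le> r \<and> (\<exists>x. cball x r \<subseteq> e)}"

definition quasi_uniform :: "real set \<Rightarrow> (real \<Rightarrow> (real^2) set set) \<Rightarrow> bool" where
  "quasi_uniform H \<T> \<longleftrightarrow>
     (\<exists>\<sigma>>0. \<forall>h\<in>H. \<forall>e\<in>\<T> h. diameter e \<le> \<sigma> * inball_diameter e) \<and>
     (\<exists>a>0. \<exists>b>0. \<forall>h\<in>H. \<forall>e\<in>\<T> h. a * h \<le> diameter e \<and> diameter e \<le> b * h)"

section \<open>The Sobolev space with zero boundary values\<close>

text \<open>The value of \<open>grad f x\<close> is unspecified where \<open>f\<close> is not differentiable.\<close>

definition grad :: "(real^2 \<Rightarrow> real) \<Rightarrow> real^2 \<Rightarrow> real^2" where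
  "grad f x = (THE D. GDERIV f x :> D)"

primrec C_k :: "nat \<Rightarrow> (real^2 \<Rightarrow> real) \<Rightarrow> bool" where
  "C_k 0 f \<longleftrightarrow> continuous_on UNIV f"
| "C_k (Suc k) f \<longleftrightarrow>
     (\<forall>x. f differentiable (at x)) \<and> (\<forall>d. C_k k (\<lambda>x. frechet_derivative f (at x) d))"

text \<open>Test functions: smooth on the plane, with compact support contained in \<open>\<Omega>\<close>.\<close>

definition C_c_infinity :: "(real^2) set \<Rightarrow> (real^2 \<Rightarrow> real) set" where
  "C_c_infinity \<Omega> =
     {f. (\<forall>k. C_k k f) \<and> (\<exists>S. compact S \<and> S \<subseteq> \<Omega> \<and> (\<forall>x. x \<notin> S \<longrightarrow> f x = 0))}"

definition L2 :: "(real^2) set \<Rightarrow> (real^2 \<Rightarrow> 'b::euclidean_space) set" where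
  "L2 \<Omega> = {f. set_borel_measurable lebesgue \<Omega> f \<and> set_integrable lebesgue \<Omega> (\<lambda>x. (norm (f x))\<^sup>2)}"

text \<open>
  The closure of the test functions in the \<open>H\<^sup>1\<close>-norm; the limit \<open>G\<close> of the gradients is the weak
  gradient of \<open>v\<close>. Functions are total; their values outside \<open>\<Omega>\<close> are irrelevant here.
\<close>

definition H1_0 :: "(real^2) set \<Rightarrow> (real^2 \<Rightarrow> real) set" where
  "H1_0 \<Omega> = {v \<in> L2 \<Omega>. \<exists>G\<in>L2 \<Omega>. \<exists>\<phi>.
     (\<forall>n. \<phi> n \<in> C_c_infinity \<Omega>) \<and>
     (\<lambda>n::nat. LINT x:\<Omega>|lebesgue. (\<phi> n x - v x)\<^sup>2) \<longlonglongrightarrow> 0 \<and>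
     (\<lambda>n. LINT x:\<Omega>|lebesgue. (norm (grad (\<phi> n) x - G x))\<^sup>2) \<longlonglongrightarrow> 0}"

section \<open>The finite element space and its degrees of freedom\<close>

definition P1 :: "(real^2) set \<Rightarrow> (real^2 \<Rightarrow> real) set" where
  "P1 e = {f. \<exists>g c. \<forall>x\<in>e. f x = inner g x + c}"

text \<open>
  Elements are closed, so each Sobolev class in the space is represented by its continuous
  representative on the closure of \<open>\<Omega>\<close>, which makes the nodal values well defined.
\<close>

definition V_h :: "(real^2) set \<Rightarrow> (real^2) set set \<Rightarrow> (real^2 \<Rightarrow> real) set" where
  "V_h \<Omega> \<T> = {v \<in> H1_0 \<Omega>. \<forall>e\<in>\<T>. v \<in> P1 e}"

text \<open>
  The nodal degrees of freedom are the values at the vertices in the open set \<open>\<Omega>\<close>, the values at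
  boundary vertices being zero; \<open>xs\<close> is a numbering of these vertices.
\<close>

definition node_numbering :: "(real^2) set \<Rightarrow> (real^2) set set \<Rightarrow> (real^2) list \<Rightarrow> bool" where
  "node_numbering \<Omega> \<T> xs \<longleftrightarrow>
     distinct xs \<and> set xs = {p \<in> \<Omega>. \<exists>e\<in>\<T>. p extreme_point_of e}"

definition dofs :: "(real^2) list \<Rightarrow> (real^2 \<Rightarrow> real) \<Rightarrow> real Matrix.vec" where
  "dofs xs u = vec_of_list (map u xs)"

section \<open>Stiffness matrices\<close>

text \<open>
  For \<open>u\<close> in \<^const>\<open>V_h\<close> the classical gradient exists off the mesh edges, a null set, and is there
  the (elementwise constant) weak gradient.
\<close>

definition fem_stiffness ::
  "(real^2) set \<Rightarrow> (real^2) set set \<Rightarrow> (real^2) list \<Rightarrow> real mat \<Rightarrow> bool" where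
  "fem_stiffness \<Omega> \<T> xs K \<longleftrightarrow>
     K \<in> carrier_mat (length xs) (length xs) \<and>
     (\<forall>u\<in>V_h \<Omega> \<T>. \<forall>v\<in>V_h \<Omega> \<T>.
        scalar_prod (dofs xs u) (K *\<^sub>v dofs xs v) =
        (LINT x:\<Omega>|lebesgue. inner (grad u x) (grad v x)))"

definition elem_grad :: "(real^2 \<Rightarrow> real) \<Rightarrow> (real^2) set \<Rightarrow> real^2" where
  "elem_grad u e = (THE g. \<exists>c. \<forall>x\<in>e. u x = inner g x + c)"

definition barycenter :: "(real^2) set \<Rightarrow> real^2" where
  "barycenter e = (1/3) *\<^sub>R (\<Sum>p | p extreme_point_of e. p)"

definition mesh_edges :: "(real^2) set set \<Rightarrow> (real^2) set set" where
  "mesh_edges \<T> = {l. \<exists>e\<in>\<T>. l edge_of e}"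

definition edge_elements :: "(real^2) set set \<Rightarrow> (real^2) set \<Rightarrow> (real^2) set set" where
  "edge_elements \<T> l = {e \<in> \<T>. l edge_of e}"

definition smoothing_domain :: "(real^2) set set \<Rightarrow> (real^2) set \<Rightarrow> (real^2) set" where
  "smoothing_domain \<T> l = (\<Union>e\<in>edge_elements \<T> l. convex hull (insert (barycenter e) l))"

text \<open>
  An edge belongs to two elements or, on the boundary, to one; in the latter case the area-weighted
  average is just the gradient on that element.
\<close>

definition edge_grad :: "(real^2) set set \<Rightarrow> (real^2 \<Rightarrow> real) \<Rightarrow> (real^2) set \<Rightarrow> real^2" where
  "edge_grad \<T> u l =
     (1 / (\<Sum>e\<in>edge_elements \<T> l. measure lebesgue e)) *\<^sub>R
     (\<Sum>e\<in>edge_elements \<T> l. measure lebesgue e *\<^sub>R elem_grad u e)"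

text \<open>
  Equals \<open>edge_grad \<T> u l\<close> on the smoothing domain of \<open>l\<close>, up to the common boundaries of smoothing
  domains, which are null sets.
\<close>

definition es_grad :: "(real^2) set set \<Rightarrow> (real^2 \<Rightarrow> real) \<Rightarrow> real^2 \<Rightarrow> real^2" where
  "es_grad \<T> u x =
     (\<Sum>l\<in>mesh_edges \<T>. indicator (smoothing_domain \<T> l) x *\<^sub>R edge_grad \<T> u l)"

definition es_stiffness ::
  "(real^2) set \<Rightarrow> (real^2) set set \<Rightarrow> (real^2) list \<Rightarrow> real mat \<Rightarrow> bool" where
  "es_stiffness \<Omega> \<T> xs K \<longleftrightarrow>
     K \<in> carrier_mat (length xs) (length xs) \<and>
     (\<forall>u\<in>V_h \<Omega> \<T>. \<forall>v\<in>V_h \<Omega> \<T>.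
        scalar_prod (dofs xs u) (K *\<^sub>v dofs xs v) =
        (LINT x:\<Omega>|lebesgue. inner (es_grad \<T> u x) (es_grad \<T> v x)))"

section \<open>Preconditioners and condition numbers\<close>

definition spd_mat :: "nat \<Rightarrow> real mat \<Rightarrow> bool" where
  "spd_mat n M \<longleftrightarrow>
     M \<in> carrier_mat n n \<and> transpose_mat M = M \<and>
     (\<forall>x\<in>carrier_vec n. x \<noteq> 0\<^sub>v n \<longrightarrow> 0 < scalar_prod x (M *\<^sub>v x))"

text \<open>
  Only real eigenvalues are considered; the matrices \<open>M\<^sup>-\<^sup>1 B\<close> to which this is applied have no others.
  Meaningless for matrices of dimension zero, which have no eigenvalues.
\<close>

definition cond_number :: "real mat \<Rightarrow> real" where
  "cond_number A = Max (spectrum A) / Min (spectrum A)"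

end

theory Submission
  imports Defs
begin

text \<open>
  The proof compares the two quadratic forms \<open>x\<^sup>T K x = \<Sum>\<^sub>e |e| |g\<^sub>e|\<^sup>2\<close> and
  \<open>x\<^sup>T K\<^sub>E\<^sub>S x = \<Sum>\<^sub>l \<Sum>\<^sub>e (|e|/3) |m\<^sub>l|\<^sup>2\<close>, where \<open>g\<^sub>e\<close> is the gradient on the element \<open>e\<close>, \<open>m\<^sub>l\<close> the
  area-weighted mean of the gradients on the elements sharing the edge \<open>l\<close>, and the inner sum runs
  over these elements. Convexity of the squared norm gives \<open>x\<^sup>T K\<^sub>E\<^sub>S x \<le> x\<^sup>T K x\<close>.
  Conversely, \<open>m\<^sub>l\<close> and \<open>g\<^sub>e\<close> have the same component along \<open>l\<close> by continuity. If the three means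
  on the edges of \<open>e\<close> are bounded by \<open>B\<close>, then \<open>u\<close> oscillates on \<open>e\<close> by at most \<open>B diam e\<close>,
  whereas on an inscribed disc of diameter \<open>\<rho>\<close> it oscillates by \<open>\<rho> |g\<^sub>e|\<close>; hence \<open>|g\<^sub>e| \<le> \<sigma> B\<close> and
  \<open>x\<^sup>T K x \<le> 3 \<sigma>\<^sup>2 x\<^sup>T K\<^sub>E\<^sub>S x\<close>. Since the extreme eigenvalues of \<open>M\<^sup>-\<^sup>1 A\<close> are the extreme values of the Rayleigh
  quotient \<open>x\<^sup>T A x / x\<^sup>T M x\<close>, the condition numbers compare with the same constant.

  The matrices are determined by their quadratic forms only because every nodal vector belongs to a
  function in \<^const>\<open>V_h\<close>. For this the piecewise affine interpolant, which is Lipschitz and vanishes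
  off \<open>\<Omega>\<close>, is truncated near zero, so that its support becomes a compact subset of \<open>\<Omega>\<close>, and then
  mollified.
\<close>

section \<open>Smooth bump functions and mollification\<close>

lemma C_k_Suc_imp_C_k: "C_k (Suc k) f \<Longrightarrow> C_k k f"
proof (induction k arbitrary: f)
  case 0
  then show ?case
    by (auto intro!: continuous_at_imp_continuous_on differentiable_imp_continuous_within)
next
  case (Suc k)
  then show ?case by (metis C_k.simps(2))
qed

text \<open>By uniqueness of the derivative any known formula \<open>f'\<close> may stand for
  \<open>frechet_derivative f\<close>, so smoothness proofs can go by induction on explicit
  formulas.\<close>

lemma C_k_SucI:
  assumes "\<And>x. (f has_derivative f' x) (at x)" and "\<And>d. C_k k (\<lambda>x. f' x d)"
  shows "C_k (Suc k) f"
proof -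
  have "frechet_derivative f (at x) = f' x" for x
    using assms(1) frechet_derivative_at by metis
  then show ?thesis
    using assms by (auto simp: differentiable_def)
qed

lemma C_k_has_derivative:
  assumes "C_k (Suc k) f"
  shows "(f has_derivative frechet_derivative f (at x)) (at x)"
  using assms frechet_derivative_works by auto

lemma C_k_const: "C_k k (\<lambda>x. c)"
proof (induction k arbitrary: c)
  case (Suc k)
  show ?case by (rule C_k_SucI[where f'="\<lambda>x d. 0"]) (use Suc in auto)
qed auto

lemma C_k_inner_left: "C_k k (\<lambda>x. inner x d)"
proof (cases k)
  case (Suc k')
  show ?thesis unfolding Suc
    by (rule C_k_SucI[where f'="\<lambda>x e. inner e d"])
      (auto intro!: derivative_eq_intros C_k_const)
qed (auto intro!: continuous_intros)

lemma C_k_add: "C_k k f \<Longrightarrow> C_k k g \<Longrightarrow> C_k k (\<lambda>x. f x + g x)"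
proof (induction k arbitrary: f g)
  case (Suc k)
  show ?case
  proof (rule C_k_SucI)
    show "((\<lambda>x. f x + g x) has_derivative
        (\<lambda>d. frechet_derivative f (at x) d + frechet_derivative g (at x) d)) (at x)" for x
      using Suc.prems by (intro has_derivative_add C_k_has_derivative[of k])
  qed (use Suc in auto)
qed (auto intro!: continuous_intros)

lemma C_k_mult: "C_k k f \<Longrightarrow> C_k k g \<Longrightarrow> C_k k (\<lambda>x. f x * g x)"
proof (induction k arbitrary: f g)
  case (Suc k)
  \<comment> \<open>The product rule leaves one factor undifferentiated in each term, so the
    induction hypothesis needs \<open>f\<close> and \<open>g\<close> themselves at order
    \<open>k\<close>.\<close>
  have *: "C_k k f" "C_k k g" using Suc.prems C_k_Suc_imp_C_k by auto
  show ?case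
  proof (rule C_k_SucI)
    show "((\<lambda>x. f x * g x) has_derivative
        (\<lambda>d. f x * frechet_derivative g (at x) d + frechet_derivative f (at x) d * g x)) (at x)" for x
      using Suc.prems by (intro has_derivative_mult C_k_has_derivative[of k])
    show "C_k k (\<lambda>x. f x * frechet_derivative g (at x) d + frechet_derivative f (at x) d * g x)" for d
      using Suc.prems * by (intro C_k_add Suc.IH) auto
  qed
qed (auto intro!: continuous_intros)

text \<open>The pole of order \<open>m\<close> makes the family closed under differentiation up to
  linear combinations; \<open>m = 0\<close> is the classical flat function.\<close>

definition flat_exp :: "nat \<Rightarrow> real \<Rightarrow> real" where
  "flat_exp m t = (if t > 0 then exp (- 1 / t) / t ^ m else 0)"

text \<open>With \<open>s = 1 / t\<close> the quotient becomes \<open>s ^ m / exp s\<close>, and the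
  exponential wins as \<open>s\<close> tends to infinity.\<close>

lemma flat_exp_tendsto_0: "(flat_exp m \<longlongrightarrow> 0) (at 0)"
proof -
  have "((\<lambda>t::real. (inverse t) ^ m / exp (inverse t)) \<longlongrightarrow> 0) (at_right 0)"
    by (rule filterlim_compose[OF tendsto_power_div_exp_0 filterlim_inverse_at_top_right])
  then have "(flat_exp m \<longlongrightarrow> 0) (at_right 0)"
    by (rule Lim_transform_eventually)
      (auto simp: eventually_at_right_less flat_exp_def eventually_at_filter field_simps exp_minus)
  moreover have "(flat_exp m \<longlongrightarrow> 0) (at_left 0)"
    by (rule Lim_transform_eventually[OF tendsto_const])
      (auto simp: flat_exp_def eventually_at_filter)
  ultimately show ?thesis by (simp add: filterlim_split_at)
qed

lemma flat_exp_has_real_derivative: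
  "(flat_exp m has_real_derivative flat_exp (m + 2) t - m * flat_exp (m + 1) t) (at t)"
proof -
  consider "t > 0" | "t < 0" | "t = 0" by linarith
  then show ?thesis
  proof cases
    case 1
    have "((\<lambda>t. exp (- 1 / t) / t ^ m) has_real_derivative
        flat_exp (m + 2) t - m * flat_exp (m + 1) t) (at t)"
    proof (cases m)
      case 0
      then show ?thesis using 1
        by (auto intro!: derivative_eq_intros simp: flat_exp_def power2_eq_square field_simps)
    next
      case (Suc n)
      show ?thesis unfolding Suc using 1
        by (auto intro!: derivative_eq_intros simp: flat_exp_def power2_eq_square field_simps)
          (cases n; simp)
    qed
    then show ?thesis
      by (rule has_field_derivative_transform_within_open[where S="{0<..}"])
        (use 1 in \<open>auto simp: flat_exp_def\<close>)
  next
    case 2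
    have "((\<lambda>t. 0) has_real_derivative 0) (at t)" by simp
    then have "(flat_exp m has_real_derivative 0) (at t)"
      by (rule has_field_derivative_transform_within_open[where S="{..<0}"])
        (use 2 in \<open>auto simp: flat_exp_def\<close>)
    then show ?thesis using 2 by (simp add: flat_exp_def)
  next
    case 3
    \<comment> \<open>The difference quotient of \<open>flat_exp m\<close> at 0 is
      \<open>flat_exp (m + 1)\<close>, which tends to 0; both terms of the claimed derivative vanish
      there.\<close>
    have "(flat_exp (m + 1) \<longlongrightarrow> 0) (at 0)" by (rule flat_exp_tendsto_0)
    then have "((\<lambda>y. (flat_exp m y - flat_exp m 0) / (y - 0)) \<longlongrightarrow> 0) (at 0)"
      by (rule Lim_transform_eventually) (auto simp: flat_exp_def)
    then show ?thesis using 3 by (simp add: has_field_derivative_iff flat_exp_def)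
  qed
qed

text \<open>The chain rule yields members with exponents \<open>m + 1\<close> and
  \<open>m + 2\<close> times the linear factor \<open>- 2 * inner x d\<close>, so the induction on
  \<open>k\<close> treats all \<open>m\<close> at once.\<close>

lemma C_k_flat_exp: "C_k k (\<lambda>x. flat_exp m (r - inner x x))"
proof (induction k arbitrary: m)
  case 0
  have "isCont (flat_exp m) t" for t
    using flat_exp_has_real_derivative DERIV_isCont by blast
  then have "continuous_on UNIV (flat_exp m)" by (simp add: continuous_at_imp_continuous_on)
  then have "continuous_on UNIV (\<lambda>x::real^2. flat_exp m (r - inner x x))"
    by (rule continuous_on_compose2) (auto intro!: continuous_on_diff continuous_on_inner continuous_on_const continuous_on_id)
  then show ?case by simp
next
  case (Suc k)
  show ?case
  proof (rule C_k_SucI)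
    fix x :: "real^2"
    have "((\<lambda>x::real^2. r - inner x x) has_derivative (\<lambda>d. - 2 * inner x d)) (at x)"
      by (auto intro!: derivative_eq_intros simp: inner_commute)
    moreover have "(flat_exp m has_derivative (*)
        (flat_exp (m + 2) (r - inner x x) + (- m) * flat_exp (m + 1) (r - inner x x)))
        (at (r - inner x x))"
      using flat_exp_has_real_derivative[of m "r - inner x x"]
      by (simp add: has_field_derivative_def)
    ultimately show "((\<lambda>x. flat_exp m (r - inner x x)) has_derivative
        (\<lambda>d. (flat_exp (m + 2) (r - inner x x) + (- m) * flat_exp (m + 1) (r - inner x x)) *
          (- 2 * inner x d))) (at x)"
      by (rule has_derivative_compose)
  next
    show "C_k k (\<lambda>x. (flat_exp (m + 2) (r - inner x x) + (- m) * flat_exp (m + 1) (r - inner x x)) *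
          (- 2 * inner x d))" for d
      by (intro C_k_mult C_k_add C_k_const Suc.IH C_k_inner_left)
  qed
qed

text \<open>The flat exponential of \<open>\<delta>\<^sup>2 - inner x x\<close> is smooth, even and
  positive exactly on the open ball of radius \<delta>; dividing by its integral gives mass
  1.\<close>

lemma smooth_bump_exists:
  assumes "\<delta> > 0"
  obtains \<eta> :: "real^2 \<Rightarrow> real" where "\<And>k. C_k k \<eta>" "\<And>x. \<eta> x \<ge> 0"
    "\<And>x. norm x \<ge> \<delta> \<Longrightarrow> \<eta> x = 0" "\<And>x. \<eta> (- x) = \<eta> x"
    "integrable lborel \<eta>" "(LINT x|lborel. \<eta> x) = 1"
proof -
  define \<zeta> :: "real^2 \<Rightarrow> real" where "\<zeta> = (\<lambda>x. flat_exp 0 (\<delta>\<^sup>2 - inner x x))"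
  have smooth: "C_k k \<zeta>" for k unfolding \<zeta>_def by (rule C_k_flat_exp)
  have cont: "continuous_on A \<zeta>" for A using smooth[of 0] continuous_on_subset by auto
  have pos: "\<zeta> x \<ge> 0" for x by (simp add: \<zeta>_def flat_exp_def)
  have pos_iff: "\<zeta> x > 0 \<longleftrightarrow> norm x < \<delta>" for x
  proof -
    have "norm x < \<delta> \<longleftrightarrow> inner x x < \<delta>\<^sup>2"
      using assms power2_less_imp_less[of "norm x" \<delta>] power_strict_mono[of "norm x" \<delta> 2]
      by (auto simp: dot_square_norm)
    then show ?thesis by (simp add: \<zeta>_def flat_exp_def)
  qed
  have zero: "\<zeta> x = 0" if "norm x \<ge> \<delta>" for x using pos_iff[of x] pos[of x] that by linarith
  have ind: "\<zeta> = (\<lambda>x. indicator (cball 0 \<delta>) x *\<^sub>R \<zeta> x)"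
    using zero by (auto simp: indicator_def fun_eq_iff)
  have int: "integrable lborel \<zeta>"
    by (subst ind, rule borel_integrable_compact) (auto intro: cont)
  \<comment> \<open>A nonnegative function with zero integral vanishes almost everywhere, which
    would make the open ball a null set.\<close>
  have "(LINT x|lborel. \<zeta> x) \<noteq> 0"
  proof
    assume "(LINT x|lborel. \<zeta> x) = 0"
    then have "AE x in lborel. \<zeta> x = 0"
      using integral_nonneg_eq_0_iff_AE[OF int] pos by simp
    then have "AE x in lborel. x \<notin> ball (0::real^2) \<delta>"
      by eventually_elim (use pos_iff less_irrefl in \<open>auto simp: dist_norm\<close>, metis less_irrefl)
    then have "ball (0::real^2) \<delta> \<in> null_sets lborel"
      by (subst AE_iff_null_sets) auto
    then show False using content_ball_pos[OF assms, of "0::real^2"]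
      by (auto simp: null_sets_def Sigma_Algebra.measure_def)
  qed
  then have I: "(LINT x|lborel. \<zeta> x) > 0"
    using Bochner_Integration.integral_nonneg[of lborel \<zeta>] pos by (simp add: order_less_le)
  define c where "c = 1 / (LINT x|lborel. \<zeta> x)"
  show ?thesis
  proof (rule that[of "\<lambda>x. c * \<zeta> x"])
    show "C_k k (\<lambda>x. c * \<zeta> x)" for k by (intro C_k_mult C_k_const smooth)
    show "c * \<zeta> (- x) = c * \<zeta> x" for x by (simp add: \<zeta>_def)
  qed (use I int zero pos in \<open>auto simp: c_def\<close>)
qed

text \<open>Differentiation under the integral falls on the kernel alone, and each directional
  derivative of a smooth kernel is again a smooth kernel; hence the induction on \<open>k\<close>
  with \<eta> arbitrary, while \<open>v\<close> is merely continuous.\<close>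

lemma C_k_convolution:
  assumes "continuous_on (cbox a b) v" and "\<And>k. C_k k \<eta>"
  shows "C_k k (\<lambda>x. integral (cbox a b) (\<lambda>z. \<eta> (x - z) * v z))"
  using assms(2)
proof (induction k arbitrary: \<eta>)
  have cont: "continuous_on A \<eta>" if "\<And>k. C_k k \<eta>" for \<eta> :: "real^2 \<Rightarrow> real" and A
    using that[of 0] continuous_on_subset by auto
  have derivative: "((\<lambda>x. integral (cbox a b) (\<lambda>z. \<eta> (x - z) * v z)) has_derivative
      (\<lambda>d. integral (cbox a b) (\<lambda>z. frechet_derivative \<eta> (at (x - z)) d * v z))) (at x)"
    if C: "\<And>k. C_k k \<eta>" for \<eta> x
  proof -
    \<comment> \<open>The Leibniz rule wants the derivative as a bounded linear map, jointly
      continuous in both variables; in finite dimension this is checked direction by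
      direction.\<close>
    define D where "D y z = Blinfun (\<lambda>d. frechet_derivative \<eta> (at (y - z)) d * v z)" for y z
    have der: "(\<eta> has_derivative frechet_derivative \<eta> (at y)) (at y)" for y
      using C_k_has_derivative C by blast
    have D: "blinfun_apply (D y z) = (\<lambda>d. frechet_derivative \<eta> (at (y - z)) d * v z)" for y z
      unfolding D_def using der has_derivative_bounded_linear
      by (intro bounded_linear_Blinfun_apply bounded_linear_mult_left
          bounded_linear_mult_const) auto
    have contD: "continuous_on (UNIV \<times> cbox a b) (\<lambda>(y, z). D y z)"
    proof (subst continuous_on_blinfun_componentwise)
      show "continuous_on (UNIV \<times> cbox a b) (\<lambda>p. blinfun_apply (case p of (y, z) \<Rightarrow> D y z) i)" for i
      proof -
        have "C_k 0 (\<lambda>x. frechet_derivative \<eta> (at x) i)" using C[of 1] by simp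
        then have "continuous_on UNIV (\<lambda>x. frechet_derivative \<eta> (at x) i)" by simp
        then have "continuous_on (UNIV \<times> cbox a b)
            (\<lambda>p. frechet_derivative \<eta> (at (fst p - snd p)) i)"
          by (rule continuous_on_compose2) (auto intro!: continuous_on_diff continuous_on_fst continuous_on_snd continuous_on_id)
        moreover have "continuous_on (UNIV \<times> cbox a b) (\<lambda>p. v (snd p))"
          by (rule continuous_on_compose2[OF assms(1)])
            (auto intro!: continuous_on_snd continuous_on_id)
        ultimately have "continuous_on (UNIV \<times> cbox a b)
            (\<lambda>p. frechet_derivative \<eta> (at (fst p - snd p)) i * v (snd p))"
          by (rule continuous_on_mult)
        then show ?thesis by (simp add: D split_beta)
      qed
    qed auto
    have "((\<lambda>x. integral (cbox a b) (\<lambda>z. \<eta> (x - z) * v z)) has_derivative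
       blinfun_apply (integral (cbox a b) (D x))) (at x within UNIV)"
    proof (rule leibniz_rule[where fx=D])
      show "((\<lambda>x. \<eta> (x - t) * v t) has_derivative blinfun_apply (D y t)) (at y within UNIV)" for y t
      proof -
        have "((\<lambda>x. x - t) has_derivative (\<lambda>d. d)) (at y)"
          by (auto intro!: derivative_eq_intros)
        from has_derivative_compose[OF this der]
        show ?thesis unfolding D by (auto intro!: derivative_eq_intros)
      qed
      show "(\<lambda>z. \<eta> (y - z) * v z) integrable_on cbox a b" for y
        by (intro integrable_continuous continuous_on_mult assms(1)
            continuous_on_compose2[OF cont[OF C, of UNIV]] continuous_on_diff continuous_on_id
            continuous_on_const) auto
    qed (use contD in auto)
    moreover have "blinfun_apply (integral (cbox a b) (D x)) =
        (\<lambda>d. integral (cbox a b) (\<lambda>z. frechet_derivative \<eta> (at (x - z)) d * v z))"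
    proof -
      have "D x integrable_on cbox a b"
      proof (rule integrable_continuous)
        have "continuous_on (cbox a b) (\<lambda>z. (\<lambda>(y, z). D y z) (x, z))"
          by (rule continuous_on_compose2[OF contD])
            (auto intro!: continuous_on_Pair continuous_on_const continuous_on_id)
        then show "continuous_on (cbox a b) (D x)" by simp
      qed
      then have "blinfun_apply (integral (cbox a b) (D x)) d =
          integral (cbox a b) (\<lambda>z. blinfun_apply (D x z) d)" for d
        by (rule blinfun_apply_integral)
      then show ?thesis by (simp add: D fun_eq_iff)
    qed
    ultimately show ?thesis by simp
  qed
  {
    case 0
    then show ?case using derivative[of \<eta>]
      by (auto intro!: continuous_at_imp_continuous_on has_derivative_continuous)
  next
    case (Suc k)
    show ?case
    proof (rule C_k_SucI[OF derivative])
      show "C_k k (\<lambda>x. integral (cbox a b) (\<lambda>z. frechet_derivative \<eta> (at (x - z)) d * v z))" for d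
      proof (rule Suc.IH)
        show "C_k k (\<lambda>x. frechet_derivative \<eta> (at x) d)" for k
          using Suc.prems[of "Suc k"] by simp
      qed
    qed (rule Suc.prems)
  }
qed

text \<open>Averaging against a probability kernel supported in the \<delta>-ball preserves the
  Lipschitz constant, moves values by at most \<open>L * \<delta>\<close>, and reproduces the slope
  wherever \<open>v\<close> is affine nearby.\<close>

lemma mollification:
  fixes v :: "real^2 \<Rightarrow> real"
  assumes lip: "L-lipschitz_on UNIV v" and supp: "bounded {x. v x \<noteq> 0}" and "\<delta> > 0"
  obtains \<phi> where "\<And>k. C_k k \<phi>" "\<And>x. \<bar>\<phi> x - v x\<bar> \<le> L * \<delta>" "L-lipschitz_on UNIV \<phi>"
    "\<And>x. (\<And>y. dist x y < \<delta> \<Longrightarrow> v y = 0) \<Longrightarrow> \<phi> x = 0"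
    "\<And>x g c. (\<And>y. dist x y < 2 * \<delta> \<Longrightarrow> v y = inner g y + c) \<Longrightarrow> GDERIV \<phi> x :> g"
proof -
  obtain \<eta> :: "real^2 \<Rightarrow> real" where \<eta>: "\<And>k. C_k k \<eta>" "\<And>x. \<eta> x \<ge> 0"
    "\<And>x. norm x \<ge> \<delta> \<Longrightarrow> \<eta> x = 0" "\<And>x. \<eta> (- x) = \<eta> x"
    "integrable lborel \<eta>" "(LINT x|lborel. \<eta> x) = 1"
    using smooth_bump_exists[OF \<open>\<delta> > 0\<close>] by metis
  obtain a where a: "{x. v x \<noteq> 0} \<subseteq> cbox (- a) a"
    using bounded_subset_cbox_symmetric[OF supp] by auto
  have L: "L \<ge> 0" using lip by (rule lipschitz_on_nonneg)
  have cont_v: "continuous_on A v" for A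
    using lipschitz_on_continuous_on[OF lip] continuous_on_subset by blast
  have cont_\<eta>: "continuous_on A \<eta>" for A using \<eta>(1)[of 0] continuous_on_subset by auto
  define av where "av f = (LINT w|lborel. \<eta> w * f w)" for f :: "real^2 \<Rightarrow> real"
  have av_int: "integrable lborel (\<lambda>w. \<eta> w * f w)" if "continuous_on UNIV f" for f
  proof -
    have "integrable lborel (\<lambda>w. indicator (cball 0 \<delta>) w *\<^sub>R (\<eta> w * f w))"
      by (rule borel_integrable_compact)
        (auto intro!: continuous_on_mult cont_\<eta> continuous_on_subset[OF that])
    also have "(\<lambda>w. indicator (cball 0 \<delta>) w *\<^sub>R (\<eta> w * f w)) = (\<lambda>w. \<eta> w * f w)"
      using \<eta>(3) by (auto simp: indicator_def fun_eq_iff)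
    finally show ?thesis .
  qed
  have av_diff: "av (\<lambda>w. f w - g w) = av f - av g"
    if "continuous_on UNIV f" "continuous_on UNIV g" for f g
    unfolding av_def using av_int[OF that(1)] av_int[OF that(2)] by (simp add: right_diff_distrib)
  have av_const: "av (\<lambda>_. c) = c" for c unfolding av_def using \<eta>(6) by simp
  have av_bound: "\<bar>av f\<bar> \<le> B"
    if f: "continuous_on UNIV f" and B: "\<And>w. norm w < \<delta> \<Longrightarrow> \<bar>f w\<bar> \<le> B" for f B
  proof -
    have "\<bar>av f\<bar> \<le> (LINT w|lborel. \<bar>\<eta> w * f w\<bar>)"
      unfolding av_def by (rule integral_abs_bound)
    also have "\<dots> \<le> (LINT w|lborel. \<eta> w * B)"
    proof (rule integral_mono)
      show "\<bar>\<eta> w * f w\<bar> \<le> \<eta> w * B" for w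
        using B[of w] \<eta>(2,3)[of w]
        by (cases "norm w < \<delta>") (auto simp: abs_mult intro!: mult_left_mono)
    qed (use av_int[OF f] \<eta>(5) in auto)
    also have "\<dots> = B" using av_const[of B] by (simp add: av_def)
    finally show ?thesis .
  qed
  \<comment> \<open>Two forms of one convolution: with the kernel shifted, \<phi> is visibly smooth;
    with \<open>v\<close> shifted, as in \<open>\<phi>_av\<close>, the estimates follow from
    \<open>av_bound\<close>. The substitution \<open>z = x + w\<close> and the evenness of \<eta>
    connect them.\<close>
  define \<phi> where "\<phi> x = integral (cbox (- a) a) (\<lambda>z. \<eta> (x - z) * v z)" for x
  have \<phi>_av: "\<phi> x = av (\<lambda>w. v (x + w))" for x
  proof -
    have cont: "continuous_on A (\<lambda>z. \<eta> (x - z) * v z)" for A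
      by (intro continuous_on_mult cont_v continuous_on_compose2[OF cont_\<eta>[of UNIV]]
          continuous_on_diff continuous_on_id continuous_on_const) auto
    have eq: "(\<lambda>z. indicator (cbox (- a) a) z *\<^sub>R (\<eta> (x - z) * v z)) = (\<lambda>z. \<eta> (x - z) * v z)"
      using a by (auto simp: indicator_def fun_eq_iff)
    have "set_integrable lborel (cbox (- a) a) (\<lambda>z. \<eta> (x - z) * v z)"
      unfolding set_integrable_def by (rule borel_integrable_compact[OF compact_cbox cont])
    then have "\<phi> x = (LINT z:cbox (- a) a|lborel. \<eta> (x - z) * v z)"
      unfolding \<phi>_def by (simp add: set_borel_integral_eq_integral(2))
    also have "\<dots> = (LINT z|lborel. \<eta> (x - z) * v z)"
      unfolding set_lebesgue_integral_def eq ..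
    also have "\<dots> = (LINT z|distr lborel borel ((+) x). \<eta> (x - z) * v z)"
      by (simp add: lborel_distr_plus)
    also have "\<dots> = (LINT w|lborel. \<eta> (- w) * v (x + w))"
      by (subst integral_distr) (use cont[of UNIV] in \<open>auto intro: borel_measurable_continuous_onI\<close>)
    finally show ?thesis by (simp add: av_def \<eta>(4))
  qed
  have cont_shift: "continuous_on UNIV (\<lambda>w. v (x + w))" for x
    by (rule continuous_on_compose2[OF cont_v[of UNIV]]) (auto intro!: continuous_intros)
  have v_lip: "\<bar>v x - v y\<bar> \<le> L * dist x y" for x y
    using lipschitz_onD[OF lip, of x y] by (simp add: dist_real_def)
  show ?thesis
  proof (rule that)
    show "C_k k \<phi>" for k
      unfolding \<phi>_def by (rule C_k_convolution[OF cont_v \<eta>(1)])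
    show "\<bar>\<phi> x - v x\<bar> \<le> L * \<delta>" for x
    proof -
      have "\<bar>av (\<lambda>w. v (x + w) - v x)\<bar> \<le> L * \<delta>"
      proof (rule av_bound)
        show "\<bar>v (x + w) - v x\<bar> \<le> L * \<delta>" if "norm w < \<delta>" for w
          using v_lip[of "x + w" x] mult_left_mono[OF less_imp_le[OF that] L] by (simp add: dist_norm)
      qed (intro continuous_on_diff cont_shift continuous_on_const)
      then show ?thesis by (simp add: av_diff cont_shift av_const \<phi>_av)
    qed
    show "L-lipschitz_on UNIV \<phi>"
    proof (rule lipschitz_onI)
      show "dist (\<phi> x) (\<phi> y) \<le> L * dist x y" for x y
      proof -
        have "\<bar>av (\<lambda>w. v (x + w) - v (y + w))\<bar> \<le> L * dist x y"
        proof (rule av_bound)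
          show "\<bar>v (x + w) - v (y + w)\<bar> \<le> L * dist x y" for w
            using v_lip[of "x + w" "y + w"] by simp
        qed (intro continuous_on_diff cont_shift continuous_on_const)
        then show ?thesis by (simp add: av_diff cont_shift \<phi>_av dist_real_def)
      qed
    qed (rule L)
    show "\<phi> x = 0" if "\<And>y. dist x y < \<delta> \<Longrightarrow> v y = 0" for x
    proof -
      have "\<bar>av (\<lambda>w. v (x + w))\<bar> \<le> 0"
        by (rule av_bound[OF cont_shift]) (use that in \<open>auto simp: dist_norm\<close>)
      then show ?thesis by (simp add: \<phi>_av)
    qed
    \<comment> \<open>The radius \<open>2 * \<delta>\<close> leaves room for two steps shorter than
      \<delta>: from \<open>x\<close> to a nearby \<open>y\<close>, and from \<open>y\<close> to
      \<open>y + w\<close> in the average. So \<phi> is affine on a whole neighbourhood of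
      \<open>x\<close>.\<close>
    show "GDERIV \<phi> x :> g" if v: "\<And>y. dist x y < 2 * \<delta> \<Longrightarrow> v y = inner g y + c" for x g c
    proof -
      define c' where "c' = av (\<lambda>w. inner g w + c)"
      have cont: "continuous_on UNIV (\<lambda>w. inner g w + c)"
        by (intro continuous_on_add continuous_on_inner continuous_on_const continuous_on_id)
      have \<phi>: "\<phi> y = inner g y + c'" if "dist x y < \<delta>" for y
      proof -
        have "\<bar>av (\<lambda>w. v (y + w) - (inner g w + c) - inner g y)\<bar> \<le> 0"
        proof (rule av_bound)
          fix w :: "real^2" assume "norm w < \<delta>"
          then have "dist x (y + w) < 2 * \<delta>"
            using that dist_triangle[of x "y + w" y] by (simp add: dist_norm)
          from v[OF this] show "\<bar>v (y + w) - (inner g w + c) - inner g y\<bar> \<le> 0"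
            by (simp add: inner_add_right)
        qed (intro continuous_on_diff cont_shift cont continuous_on_const)
        then show ?thesis
          by (simp add: av_diff cont_shift cont continuous_on_diff av_const \<phi>_av c'_def)
      qed
      have "((\<lambda>y. inner g y + c') has_derivative (\<lambda>h. inner h g)) (at x)"
        by (auto intro!: derivative_eq_intros simp: inner_commute)
      then have "(\<phi> has_derivative (\<lambda>h. inner h g)) (at x)"
        by (rule has_derivative_transform_within[where d=\<delta>])
          (use \<phi> \<open>\<delta> > 0\<close> in \<open>auto simp: dist_commute\<close>)
      then show ?thesis by (simp add: gderiv_def)
    qed
  qed
qed

section \<open>Gradients of differentiable and of Lipschitz functions\<close>

lemma grad_eq: "GDERIV f x :> D \<Longrightarrow> grad f x = D"
  unfolding grad_def
proof (rule the_equality)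
  fix D' assume "GDERIV f x :> D" "GDERIV f x :> D'"
  then have "(\<lambda>h. inner h D) = (\<lambda>h. inner h D')"
    unfolding gderiv_def by (rule has_derivative_unique)
  then show "D' = D" by (metis inner_commute vector_eq_rdot)
qed

text \<open>From this explicit formula the continuity of the gradient of a \<open>C_k 1\<close>
  function is read off later.\<close>

lemma GDERIV_frechet_derivative:
  fixes f :: "real^2 \<Rightarrow> real"
  assumes "f differentiable (at x)"
  shows "GDERIV f x :> (\<Sum>b\<in>Basis. frechet_derivative f (at x) b *\<^sub>R b)"
proof -
  have der: "(f has_derivative frechet_derivative f (at x)) (at x)"
    using assms by (simp add: frechet_derivative_works)
  then interpret linear "frechet_derivative f (at x)"
    by (rule has_derivative_linear)
  have "frechet_derivative f (at x) h =
      inner h (\<Sum>b\<in>Basis. frechet_derivative f (at x) b *\<^sub>R b)" for h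
  proof -
    have "frechet_derivative f (at x) h =
        frechet_derivative f (at x) (\<Sum>b\<in>Basis. inner h b *\<^sub>R b)"
      by (simp add: euclidean_representation)
    also have "\<dots> = (\<Sum>b\<in>Basis. inner h b * frechet_derivative f (at x) b)"
      by (simp add: sum scale)
    finally show ?thesis by (simp add: inner_sum_right mult.commute)
  qed
  then have "frechet_derivative f (at x) =
      (\<lambda>h. inner h (\<Sum>b\<in>Basis. frechet_derivative f (at x) b *\<^sub>R b))"
    by (rule ext)
  with der show ?thesis unfolding gderiv_def by argo
qed

text \<open>The derivative in the direction \<open>D\<close> itself is the squared norm of
  \<open>D\<close>, whereas difference quotients in that direction are bounded by
  \<open>L * norm D\<close>.\<close>

lemma norm_gradient_le_lipschitz:
  fixes f :: "real^2 \<Rightarrow> real"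
  assumes "L-lipschitz_on UNIV f" "GDERIV f x :> D"
  shows "norm D \<le> L"
proof (cases "D = 0")
  case False
  have "((\<lambda>t. x + t *\<^sub>R D) has_derivative (\<lambda>t. t *\<^sub>R D)) (at 0)"
    by (auto intro!: derivative_eq_intros)
  moreover have "(f has_derivative (\<lambda>h. inner h D)) (at (x + 0 *\<^sub>R D))"
    using assms(2) by (simp add: gderiv_def)
  ultimately have "((\<lambda>t. f (x + t *\<^sub>R D)) has_derivative (\<lambda>t. inner (t *\<^sub>R D) D)) (at 0)"
    by (rule has_derivative_compose)
  then have "((\<lambda>t. f (x + t *\<^sub>R D)) has_real_derivative inner D D) (at 0)"
    by (simp add: has_field_derivative_def mult.commute[of _ "inner D D"])
  then have "((\<lambda>t. (f (x + t *\<^sub>R D) - f (x + 0 *\<^sub>R D)) / (t - 0)) \<longlongrightarrow> inner D D) (at 0)"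
    by (simp add: has_field_derivative_iff)
  then have "inner D D \<le> L * norm D"
  proof (rule tendsto_upperbound)
    show "\<forall>\<^sub>F t in at 0. (f (x + t *\<^sub>R D) - f (x + 0 *\<^sub>R D)) / (t - 0) \<le> L * norm D"
    proof (rule eventually_at_filter[THEN iffD2], rule always_eventually, intro allI impI)
      fix t :: real assume "t \<noteq> 0"
      have "\<bar>f (x + t *\<^sub>R D) - f x\<bar> \<le> L * (\<bar>t\<bar> * norm D)"
        using lipschitz_onD[OF assms(1), of "x + t *\<^sub>R D" x] by (simp add: dist_norm)
      then have "\<bar>(f (x + t *\<^sub>R D) - f x) / t\<bar> \<le> L * norm D"
        using \<open>t \<noteq> 0\<close> by (simp add: abs_divide field_simps)
      then show "(f (x + t *\<^sub>R D) - f (x + 0 *\<^sub>R D)) / (t - 0) \<le> L * norm D"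
        using abs_le_D1 by fastforce
    qed
  qed auto
  then have "norm D * norm D \<le> L * norm D" by (simp add: dot_square_norm power2_eq_square)
  then show ?thesis using False by simp
qed (use assms(1) lipschitz_on_nonneg in auto)

section \<open>Lipschitz piecewise affine functions in the Sobolev space\<close>

text \<open>Dominated convergence with the constant majorant \<open>B\<close>, integrable because
  \<Omega> has finite measure.\<close>

lemma set_lebesgue_integral_bounded_tendsto_0:
  fixes f :: "nat \<Rightarrow> 'a::euclidean_space \<Rightarrow> real"
  assumes [measurable]: "\<Omega> \<in> sets lebesgue" "\<And>n. f n \<in> borel_measurable lebesgue"
    and "emeasure lebesgue \<Omega> < \<infinity>"
    and bound: "\<And>n. AE x in lebesgue. x \<in> \<Omega> \<longrightarrow> \<bar>f n x\<bar> \<le> B"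
    and lim: "AE x in lebesgue. x \<in> \<Omega> \<longrightarrow> (\<lambda>n. f n x) \<longlonglongrightarrow> 0"
  shows "(\<lambda>n. LINT x:\<Omega>|lebesgue. f n x) \<longlonglongrightarrow> 0"
proof -
  have "(\<lambda>n. LINT x|lebesgue. indicator \<Omega> x *\<^sub>R f n x) \<longlonglongrightarrow> (LINT (x::'a)|lebesgue. 0)"
  proof (rule integral_dominated_convergence[where w="\<lambda>x. indicator \<Omega> x * B"])
    show "integrable lebesgue (\<lambda>x. indicator \<Omega> x * B)"
      using assms(3) by (intro integrable_mult_left integrable_real_indicator) auto
    show "AE x in lebesgue. (\<lambda>n. indicator \<Omega> x *\<^sub>R f n x) \<longlonglongrightarrow> 0"
      using lim by eventually_elim (auto simp: indicator_def)
    show "AE x in lebesgue. norm (indicator \<Omega> x *\<^sub>R f n x) \<le> indicator \<Omega> x * B" for n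
      using bound[of n] by eventually_elim (auto simp: indicator_def)
  qed auto
  then show ?thesis by (simp add: set_lebesgue_integral_def)
qed

lemma borel_measurable_lebesgue_continuous:
  "continuous_on UNIV f \<Longrightarrow> f \<in> borel_measurable lebesgue"
  by (intro measurable_completion) (simp add: borel_measurable_continuous_onI)

text \<open>For positive \<epsilon> this truncation is 1-Lipschitz and sends the band from
  -\<epsilon> to \<epsilon> to 0; on either side of the band it is a mere shift by a constant, so it
  leaves slopes unchanged there.\<close>

definition soft_threshold :: "real \<Rightarrow> real \<Rightarrow> real" where
  "soft_threshold \<epsilon> t = t - max (- \<epsilon>) (min \<epsilon> t)"

text \<open>Mollifying \<open>u\<close> itself could spread its support beyond \<Omega>. The
  truncated function is nonzero only where \<open>u\<close> exceeds \<epsilon> in size, and a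
  mollification of radius \<delta> only reaches points where \<open>u\<close> still has at least
  half that size.\<close>

lemma soft_threshold_approximation:
  fixes u :: "real^2 \<Rightarrow> real"
  assumes lip: "L-lipschitz_on UNIV u" and "bounded \<Omega>" and zero: "\<And>x. x \<notin> \<Omega> \<Longrightarrow> u x = 0"
    and "\<epsilon> > 0" and \<delta>_def: "\<delta> = \<epsilon> / (2 * (L + 1))"
  obtains \<phi> where "\<phi> \<in> C_c_infinity \<Omega>" "\<And>x. \<bar>\<phi> x - u x\<bar> \<le> 2 * \<epsilon>" "L-lipschitz_on UNIV \<phi>"
    "\<And>x g c. (\<And>y. dist x y < 2 * \<delta> \<Longrightarrow> soft_threshold \<epsilon> (u y) = inner g y + c)
      \<Longrightarrow> GDERIV \<phi> x :> g"
proof -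
  have L: "L \<ge> 0" using lip by (rule lipschitz_on_nonneg)
  have "\<delta> > 0" using L \<open>\<epsilon> > 0\<close> by (simp add: \<delta>_def)
  \<comment> \<open>Over a distance \<delta> the function \<open>u\<close> changes by at most half
    of \<epsilon>; \<open>L + 1\<close> in the definition of \<delta> avoids division by zero when
    \<open>L = 0\<close>.\<close>
  have L\<delta>: "L * \<delta> \<le> \<epsilon> / 2"
  proof -
    have "L * \<delta> \<le> (L + 1) * \<delta>" using \<open>\<delta> > 0\<close> by simp
    also have "\<dots> = \<epsilon> / 2" using L by (simp add: \<delta>_def field_simps)
    finally show ?thesis .
  qed
  have u_lip: "\<bar>u x - u y\<bar> \<le> L * dist x y" for x y
    using lipschitz_onD[OF lip, of x y] by (simp add: dist_real_def)
  define v where "v y = soft_threshold \<epsilon> (u y)" for y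
  have v_lip: "L-lipschitz_on UNIV v"
  proof (rule lipschitz_onI)
    show "dist (v x) (v y) \<le> L * dist x y" for x y
    proof -
      have "\<bar>v x - v y\<bar> \<le> \<bar>u x - u y\<bar>"
        using \<open>\<epsilon> > 0\<close> unfolding v_def soft_threshold_def by (auto simp: max_def min_def)
      then show ?thesis using u_lip[of x y] by (simp add: dist_real_def)
    qed
  qed (rule L)
  have v_zero: "v y = 0" if "\<bar>u y\<bar> \<le> \<epsilon>" for y
    using that \<open>\<epsilon> > 0\<close> by (auto simp: v_def soft_threshold_def)
  have "{x. v x \<noteq> 0} \<subseteq> \<Omega>"
    using zero v_zero \<open>\<epsilon> > 0\<close> by force
  then have "bounded {x. v x \<noteq> 0}" using \<open>bounded \<Omega>\<close> bounded_subset by blast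
  from mollification[OF v_lip this \<open>\<delta> > 0\<close>] obtain \<phi> where \<phi>: "\<And>k. C_k k \<phi>"
    "\<And>x. \<bar>\<phi> x - v x\<bar> \<le> L * \<delta>" "L-lipschitz_on UNIV \<phi>"
    "\<And>x. (\<And>y. dist x y < \<delta> \<Longrightarrow> v y = 0) \<Longrightarrow> \<phi> x = 0"
    "\<And>x g c. (\<And>y. dist x y < 2 * \<delta> \<Longrightarrow> v y = inner g y + c) \<Longrightarrow> GDERIV \<phi> x :> g"
    by blast
  show ?thesis
  proof (rule that[of \<phi>])
    \<comment> \<open>Off \<open>S\<close> the size of \<open>u\<close> is below half of \<epsilon>,
      hence at most \<epsilon> throughout the \<delta>-ball, where \<open>v\<close> is therefore 0.
      Since \<open>u\<close> vanishes off \<Omega>, the closed set \<open>S\<close> lies inside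
      \<Omega>.\<close>
    define S where "S = {x. \<epsilon> / 2 \<le> \<bar>u x\<bar>}"
    have "S \<subseteq> \<Omega>" using zero \<open>\<epsilon> > 0\<close> by (force simp: S_def)
    moreover have "closed S" unfolding S_def
      by (intro closed_Collect_le continuous_on_const continuous_on_rabs
          lipschitz_on_continuous_on[OF lip])
    ultimately have "compact S"
      using \<open>bounded \<Omega>\<close> bounded_subset compact_eq_bounded_closed by blast
    moreover have "\<phi> x = 0" if "x \<notin> S" for x
    proof (rule \<phi>(4))
      fix y assume "dist x y < \<delta>"
      then have "L * dist x y \<le> L * \<delta>" using L by (simp add: mult_left_mono)
      then have "\<bar>u x - u y\<bar> \<le> \<epsilon> / 2" using u_lip[of x y] L\<delta> by linarith
      moreover have "\<bar>u x\<bar> < \<epsilon> / 2" using that by (simp add: S_def)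
      ultimately show "v y = 0" by (intro v_zero) linarith
    qed
    ultimately show "\<phi> \<in> C_c_infinity \<Omega>"
      using \<phi>(1) \<open>S \<subseteq> \<Omega>\<close> by (auto simp: C_c_infinity_def)
    show "\<bar>\<phi> x - u x\<bar> \<le> 2 * \<epsilon>" for x
    proof -
      have "\<bar>v x - u x\<bar> \<le> \<epsilon>" using \<open>\<epsilon> > 0\<close> by (auto simp: v_def soft_threshold_def)
      then show ?thesis using \<phi>(2)[of x] L\<delta> \<open>\<epsilon> > 0\<close> by linarith
    qed
  qed (use \<phi>(3,5) v_def in auto)
qed

text \<open>The truncated and mollified functions converge uniformly, and their gradients are
  bounded by \<open>L\<close> and eventually constant at almost every point of \<Omega>. Dominated
  convergence gives both limits in \<open>H1_0\<close>, the pointwise limit of the gradients serving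
  as weak gradient.\<close>

lemma lipschitz_piecewise_affine_in_H1_0:
  fixes u :: "real^2 \<Rightarrow> real"
  assumes "open \<Omega>" "bounded \<Omega>"
    and \<T>: "finite \<T>" "\<And>e. e \<in> \<T> \<Longrightarrow> convex e" "\<Omega> \<subseteq> \<Union>\<T>" "\<And>e. e \<in> \<T> \<Longrightarrow> u \<in> P1 e"
    and lip: "L-lipschitz_on UNIV u" and zero: "\<And>x. x \<notin> \<Omega> \<Longrightarrow> u x = 0"
  shows "u \<in> H1_0 \<Omega>"
proof -
  have L: "L \<ge> 0" using lip by (rule lipschitz_on_nonneg)
  have u_lip: "\<bar>u x - u y\<bar> \<le> L * dist x y" for x y
    using lipschitz_onD[OF lip, of x y] by (simp add: dist_real_def)
  have cont_u: "continuous_on UNIV u" using lipschitz_on_continuous_on[OF lip] .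
  have \<Omega>[measurable]: "\<Omega> \<in> sets lebesgue" using \<open>open \<Omega>\<close> by auto
  have fin: "emeasure lebesgue \<Omega> < \<infinity>"
    using \<open>bounded \<Omega>\<close> \<open>open \<Omega>\<close> emeasure_bounded_finite by (auto simp: less_top)
  define \<epsilon> where "\<epsilon> n = inverse (real (Suc n))" for n
  define \<delta> where "\<delta> n = \<epsilon> n / (2 * (L + 1))" for n
  have \<epsilon>_lim: "\<epsilon> \<longlonglongrightarrow> 0" unfolding \<epsilon>_def by (rule LIMSEQ_inverse_real_of_nat)
  have \<delta>_lim: "(\<lambda>n. 2 * \<delta> n) \<longlonglongrightarrow> 0"
    unfolding \<delta>_def using tendsto_mult_left_zero[OF \<epsilon>_lim, of "1 / (L + 1)"] L by simp
  have "\<forall>n. \<exists>\<phi>. \<phi> \<in> C_c_infinity \<Omega> \<and> (\<forall>x. \<bar>\<phi> x - u x\<bar> \<le> 2 * \<epsilon> n) \<and> L-lipschitz_on UNIV \<phi> \<and>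
      (\<forall>x g c. (\<forall>y. dist x y < 2 * \<delta> n \<longrightarrow> soft_threshold (\<epsilon> n) (u y) = inner g y + c)
        \<longrightarrow> GDERIV \<phi> x :> g)"
  proof
    fix n
    have "\<epsilon> n > 0" by (simp add: \<epsilon>_def)
    from soft_threshold_approximation[OF lip \<open>bounded \<Omega>\<close> zero this \<delta>_def]
    show "\<exists>\<phi>. \<phi> \<in> C_c_infinity \<Omega> \<and> (\<forall>x. \<bar>\<phi> x - u x\<bar> \<le> 2 * \<epsilon> n) \<and> L-lipschitz_on UNIV \<phi> \<and>
      (\<forall>x g c. (\<forall>y. dist x y < 2 * \<delta> n \<longrightarrow> soft_threshold (\<epsilon> n) (u y) = inner g y + c)
        \<longrightarrow> GDERIV \<phi> x :> g)" by metis
  qed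
  from choice[OF this] obtain \<phi> where \<phi>: "\<And>n. \<phi> n \<in> C_c_infinity \<Omega>"
    "\<And>n x. \<bar>\<phi> n x - u x\<bar> \<le> 2 * \<epsilon> n" "\<And>n. L-lipschitz_on UNIV (\<phi> n)"
    "\<And>n x g c. (\<And>y. dist x y < 2 * \<delta> n \<Longrightarrow> soft_threshold (\<epsilon> n) (u y) = inner g y + c)
        \<Longrightarrow> GDERIV (\<phi> n) x :> g"
    by blast
  have cont_\<phi>: "continuous_on UNIV (\<phi> n)" for n
    using \<phi>(3) lipschitz_on_continuous_on by blast
  have C1: "C_k 1 (\<phi> n)" for n using \<phi>(1)[of n] by (auto simp: C_c_infinity_def)
  have gderiv: "GDERIV (\<phi> n) x :> grad (\<phi> n) x" for n x
    using GDERIV_frechet_derivative[of "\<phi> n" x] C1[of n] grad_eq by force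
  have grad_le: "norm (grad (\<phi> n) x) \<le> L" for n x
    by (rule norm_gradient_le_lipschitz[OF \<phi>(3) gderiv])
  have cont_grad: "continuous_on UNIV (grad (\<phi> n))" for n
  proof -
    have "grad (\<phi> n) = (\<lambda>x. \<Sum>b\<in>Basis. frechet_derivative (\<phi> n) (at x) b *\<^sub>R b)"
      using GDERIV_frechet_derivative[of "\<phi> n"] C1[of n] grad_eq by force
    moreover have "continuous_on UNIV (\<lambda>x. \<Sum>b\<in>Basis. frechet_derivative (\<phi> n) (at x) b *\<^sub>R b)"
      using C1[of n] by (intro continuous_on_sum continuous_on_scaleR continuous_on_const) auto
    ultimately show ?thesis by simp
  qed
  \<comment> \<open>If \<open>u\<close> vanishes near \<open>x\<close>, so do its truncations. If
    \<open>u x \<noteq> 0\<close>, then eventually \<open>u\<close> keeps its sign near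
    \<open>x\<close> and stays above \<open>\<epsilon> n\<close> in size, so truncation only shifts
    it by a constant and keeps the slope \<open>g\<close>.\<close>
  have grad_limit: "\<forall>\<^sub>F n in sequentially. grad (\<phi> n) x = g"
    if r: "r > 0" "\<And>y. dist x y < r \<Longrightarrow> u y = inner g y + c" and "u x \<noteq> 0 \<or> g = 0 \<and> c = 0"
    for x g c r
    using that(3)
  proof
    assume "g = 0 \<and> c = 0"
    moreover have "\<forall>\<^sub>F n in sequentially. 2 * \<delta> n < r"
      using order_tendstoD(2)[OF \<delta>_lim r(1)] .
    then show ?thesis
    proof eventually_elim
      case (elim n)
      show ?case
      proof (rule grad_eq, rule \<phi>(4)[where c=0])
        show "soft_threshold (\<epsilon> n) (u y) = inner g y + 0" if "dist x y < 2 * \<delta> n" for y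
          using r(2)[of y] \<open>g = 0 \<and> c = 0\<close> that elim by (simp add: soft_threshold_def \<epsilon>_def)
      qed
    qed
  next
    assume "u x \<noteq> 0"
    \<comment> \<open>Within distance \<open>s\<close> of \<open>x\<close> the function
      \<open>u\<close> changes by at most half of \<open>\<bar>u x\<bar>\<close>.\<close>
    define s where "s = \<bar>u x\<bar> / (2 * (L + 1))"
    have "s > 0" using \<open>u x \<noteq> 0\<close> L by (simp add: s_def)
    have "\<forall>\<^sub>F n in sequentially. 2 * \<delta> n < r" "\<forall>\<^sub>F n in sequentially. 2 * \<delta> n < s"
      "\<forall>\<^sub>F n in sequentially. \<epsilon> n < \<bar>u x\<bar> / 2"
      by (rule order_tendstoD(2)[OF \<delta>_lim] order_tendstoD(2)[OF \<epsilon>_lim];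
          use r(1) \<open>s > 0\<close> \<open>u x \<noteq> 0\<close> in simp)+
    then show ?thesis
    proof eventually_elim
      case (elim n)
      show ?case
      proof (rule grad_eq, rule \<phi>(4))
        fix y assume y: "dist x y < 2 * \<delta> n"
        have "L * dist x y \<le> (L + 1) * s"
          using y elim L by (intro mult_mono) auto
        also have "\<dots> = \<bar>u x\<bar> / 2" using L by (simp add: s_def field_simps)
        finally have "\<bar>u x - u y\<bar> \<le> \<bar>u x\<bar> / 2" using u_lip[of x y] by linarith
        then have uy: "\<epsilon> n \<le> u y" if "u x > 0" using elim(3) that by linarith
        have uy': "u y \<le> - \<epsilon> n" if "u x < 0"
          using elim(3) that \<open>\<bar>u x - u y\<bar> \<le> \<bar>u x\<bar> / 2\<close> by linarith
        have "\<epsilon> n > 0" by (simp add: \<epsilon>_def)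
        have "soft_threshold (\<epsilon> n) (u y) = u y - sgn (u x) * \<epsilon> n"
        proof (cases "u x > 0")
          case True
          then show ?thesis using uy \<open>\<epsilon> n > 0\<close> by (simp add: soft_threshold_def min_def max_def)
        next
          case False
          then have "u x < 0" using \<open>u x \<noteq> 0\<close> by simp
          then show ?thesis using uy' \<open>\<epsilon> n > 0\<close> by (simp add: soft_threshold_def min_def max_def)
        qed
        then show "soft_threshold (\<epsilon> n) (u y) = inner g y + (c - sgn (u x) * \<epsilon> n)"
          using r(2)[of y] y elim by simp
      qed
    qed
  qed
  obtain gg cc where gg: "\<And>e x. e \<in> \<T> \<Longrightarrow> x \<in> e \<Longrightarrow> u x = inner (gg e) x + cc e"
  proof -
    have "\<forall>e\<in>\<T>. \<exists>p. \<forall>x\<in>e. u x = inner (fst p) x + snd p"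
      using \<T>(4) by (auto simp: P1_def)
    then obtain p where "\<forall>e\<in>\<T>. \<forall>x\<in>e. u x = inner (fst (p e)) x + snd (p e)"
      using bchoice[of \<T> "\<lambda>e p. \<forall>x\<in>e. u x = inner (fst p) x + snd p"] by blast
    then show ?thesis by (intro that[of "\<lambda>e. fst (p e)" "\<lambda>e. snd (p e)"]) blast
  qed
  \<comment> \<open>Besides the element boundaries, the exceptional set contains the zero line of
    each affine formula for \<open>u\<close> that is not identically zero.\<close>
  define N where "N = (\<Union>e\<in>\<T>. frontier e) \<union>
      (\<Union>e\<in>{e \<in> \<T>. gg e \<noteq> 0 \<or> - cc e \<noteq> 0}. {x. inner (gg e) x = - cc e})"
  have "negligible N"
    unfolding N_def
  proof (rule negligible_Un)
    show "negligible (\<Union>e\<in>\<T>. frontier e)"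
      using \<T>(1,2) negligible_convex_frontier by (intro negligible_Union) auto
    have "negligible {x. inner (gg e) x = - cc e}" if "gg e \<noteq> 0 \<or> - cc e \<noteq> 0" for e
      using that by (rule negligible_hyperplane)
    then show "negligible (\<Union>e\<in>{e \<in> \<T>. gg e \<noteq> 0 \<or> - cc e \<noteq> 0}. {x. inner (gg e) x = - cc e})"
      using \<T>(1) by (intro negligible_Union) auto
  qed
  then have "AE x in lebesgue. x \<notin> N"
    by (simp add: negligible_iff_null_sets AE_not_in)
  then have limit: "AE x in lebesgue. x \<in> \<Omega> \<longrightarrow> (\<exists>g. norm g \<le> L \<and>
      (\<forall>\<^sub>F n in sequentially. grad (\<phi> n) x = g))"
  proof eventually_elim
    case (elim x)
    show ?case
    proof
      assume "x \<in> \<Omega>"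
      then obtain e where e: "e \<in> \<T>" "x \<in> e" using \<T>(3) by auto
      then have "x \<in> interior e" using elim closure_subset by (auto simp: N_def frontier_def)
      then obtain r where r: "r > 0" "ball x r \<subseteq> e" using mem_interior by blast
      have "\<forall>\<^sub>F n in sequentially. grad (\<phi> n) x = gg e"
      proof (rule grad_limit[OF r(1)])
        show "u y = inner (gg e) y + cc e" if "dist x y < r" for y
          using r(2) that gg[OF e(1)] by (auto simp: subset_eq)
        show "u x \<noteq> 0 \<or> gg e = 0 \<and> cc e = 0"
          using elim e gg[OF e] by (auto simp: N_def)
      qed
      moreover from eventually_happens'[OF sequentially_bot this] obtain n where "grad (\<phi> n) x = gg e"
        by blast
      then have "norm (gg e) \<le> L" using grad_le[of n x] by simp
      ultimately show "\<exists>g. norm g \<le> L \<and> (\<forall>\<^sub>F n in sequentially. grad (\<phi> n) x = g)" by blast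
    qed
  qed
  define G where "G x = lim (\<lambda>n. grad (\<phi> n) x)" for x
  have G_eq: "G x = g" if "\<forall>\<^sub>F n in sequentially. grad (\<phi> n) x = g" for x g
    unfolding G_def by (rule limI, rule tendsto_eventually[OF that])
  have [measurable]: "grad (\<phi> n) \<in> borel_measurable lebesgue" for n
    using cont_grad by (rule borel_measurable_lebesgue_continuous)
  have [measurable]: "\<phi> n \<in> borel_measurable lebesgue" for n
    using cont_\<phi> by (rule borel_measurable_lebesgue_continuous)
  have [measurable]: "u \<in> borel_measurable lebesgue"
    using cont_u by (rule borel_measurable_lebesgue_continuous)
  have G_meas[measurable]: "G \<in> borel_measurable lebesgue"
    unfolding G_def by measurable
  have G_le: "AE x in lebesgue. x \<in> \<Omega> \<longrightarrow> norm (G x) \<le> L"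
    using limit by eventually_elim (use G_eq in blast)
  obtain B where B: "\<And>x. \<bar>u x\<bar> \<le> B"
  proof -
    have "bounded (u ` closure \<Omega>)"
      using \<open>bounded \<Omega>\<close> continuous_on_subset[OF cont_u]
      by (intro compact_imp_bounded compact_continuous_image) auto
    then obtain B where "\<And>x. x \<in> \<Omega> \<Longrightarrow> \<bar>u x\<bar> \<le> B"
      unfolding bounded_iff using closure_subset by force
    then have "\<bar>u x\<bar> \<le> max B 0" for x using zero[of x] by (cases "x \<in> \<Omega>") fastforce+
    then show ?thesis by (rule that)
  qed
  have "u \<in> L2 \<Omega>"
    unfolding L2_def set_borel_measurable_def set_integrable_def
  proof (intro CollectI conjI)
    show "integrable lebesgue (\<lambda>x. indicator \<Omega> x *\<^sub>R (norm (u x))\<^sup>2)"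
      using fin B power_mono[OF B, of _ 2]
      by (intro integrableI_bounded_set_indicator[where B="B\<^sup>2"]) auto
  qed measurable
  moreover have "G \<in> L2 \<Omega>"
    unfolding L2_def set_borel_measurable_def set_integrable_def
  proof (intro CollectI conjI)
    show "integrable lebesgue (\<lambda>x. indicator \<Omega> x *\<^sub>R (norm (G x))\<^sup>2)"
    proof (rule integrableI_bounded_set_indicator[where B="L\<^sup>2"])
      show "AE x in lebesgue. x \<in> \<Omega> \<longrightarrow> norm ((norm (G x))\<^sup>2) \<le> L\<^sup>2"
        using G_le by eventually_elim (simp add: power_mono)
    qed (use fin in auto)
  qed measurable
  moreover have "(\<lambda>n. LINT x:\<Omega>|lebesgue. (\<phi> n x - u x)\<^sup>2) \<longlonglongrightarrow> 0"
  \<comment> \<open>The bound 4 is that of \<open>(2 * \<epsilon> n)\<^sup>2\<close>, as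
    \<open>\<epsilon> n \<le> 1\<close>.\<close>
  proof (rule set_lebesgue_integral_bounded_tendsto_0[where B=4])
    have bd: "\<bar>(\<phi> n x - u x)\<^sup>2\<bar> \<le> (2 * \<epsilon> n)\<^sup>2" for n x
      using power_mono[OF \<phi>(2)[of n x], of 2] by simp
    show "AE x in lebesgue. x \<in> \<Omega> \<longrightarrow> \<bar>(\<phi> n x - u x)\<^sup>2\<bar> \<le> 4" for n
    proof (intro AE_I2 impI)
      have "(2 * \<epsilon> n)\<^sup>2 \<le> (2 * 1)\<^sup>2"
        unfolding \<epsilon>_def by (intro power_mono mult_left_mono) (auto simp: inverse_le_1_iff)
      then show "\<bar>(\<phi> n x - u x)\<^sup>2\<bar> \<le> 4" for x using bd[of n x] by simp
    qed
    show "AE x in lebesgue. x \<in> \<Omega> \<longrightarrow> (\<lambda>n. (\<phi> n x - u x)\<^sup>2) \<longlonglongrightarrow> 0"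
    proof (intro AE_I2 impI)
      have "(\<lambda>n. (2 * \<epsilon> n)\<^sup>2) \<longlonglongrightarrow> 0"
        using tendsto_power[OF tendsto_mult_right[OF \<epsilon>_lim, of 2], of 2] by simp
      then show "(\<lambda>n. (\<phi> n x - u x)\<^sup>2) \<longlonglongrightarrow> 0" for x
        by (rule Lim_null_comparison[rotated]) (use bd[of _ x] in auto)
    qed
  qed (use fin in auto)
  moreover have "(\<lambda>n. LINT x:\<Omega>|lebesgue. (norm (grad (\<phi> n) x - G x))\<^sup>2) \<longlonglongrightarrow> 0"
  proof (rule set_lebesgue_integral_bounded_tendsto_0[where B="(2 * L)\<^sup>2"])
    show "AE x in lebesgue. x \<in> \<Omega> \<longrightarrow> \<bar>(norm (grad (\<phi> n) x - G x))\<^sup>2\<bar> \<le> (2 * L)\<^sup>2" for n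
      using G_le
    proof eventually_elim
      case (elim x)
      have "norm (grad (\<phi> n) x - G x) \<le> 2 * L" if "x \<in> \<Omega>"
        using norm_triangle_ineq4[of "grad (\<phi> n) x" "G x"] grad_le[of n x] elim that by auto
      then show ?case using power_mono[of _ "2 * L" 2] by (auto simp del: power_mult_distrib)
    qed
    show "AE x in lebesgue. x \<in> \<Omega> \<longrightarrow> (\<lambda>n. (norm (grad (\<phi> n) x - G x))\<^sup>2) \<longlonglongrightarrow> 0"
      using limit
    proof eventually_elim
      case (elim x)
      show ?case
      proof
        assume "x \<in> \<Omega>"
        with elim obtain g where g: "\<forall>\<^sub>F n in sequentially. grad (\<phi> n) x = g" by blast
        then have "\<forall>\<^sub>F n in sequentially. (norm (grad (\<phi> n) x - G x))\<^sup>2 = 0"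
          by eventually_elim (simp add: G_eq[OF g])
        then show "(\<lambda>n. (norm (grad (\<phi> n) x - G x))\<^sup>2) \<longlonglongrightarrow> 0" by (rule tendsto_eventually)
      qed
    qed
  qed (use fin in auto)
  ultimately show ?thesis
    unfolding H1_0_def using \<phi>(1) by blast
qed

section \<open>Generalised Rayleigh quotients and condition numbers\<close>

definition quad_form :: "real mat \<Rightarrow> real Matrix.vec \<Rightarrow> real" where
  "quad_form A x = scalar_prod x (A *\<^sub>v x)"

lemma quad_form_smult:
  assumes "A \<in> carrier_mat n n" "x \<in> carrier_vec n"
  shows "quad_form A (c \<cdot>\<^sub>v x) = c\<^sup>2 * quad_form A x"
  using assms by (simp add: quad_form_def mult_mat_vec power2_eq_square)

lemma scalar_prod_self_sum:
  fixes x :: "real Matrix.vec"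
  shows "x \<in> carrier_vec n \<Longrightarrow> scalar_prod x x = (\<Sum>i<n. (x $ i)\<^sup>2)"
  by (auto simp: scalar_prod_def power2_eq_square lessThan_atLeast0)

lemma scalar_prod_self_pos:
  assumes "x \<in> carrier_vec n" "x \<noteq> 0\<^sub>v n"
  shows "scalar_prod x x > (0::real)"
proof -
  obtain i where "i < n" "x $ i \<noteq> 0" using assms by (auto simp: vec_eq_iff)
  then have "(\<Sum>i<n. (x $ i)\<^sup>2) > 0" by (intro sum_pos2[of _ i]) auto
  then show ?thesis using scalar_prod_self_sum[OF assms(1)] by simp
qed

lemma smult_mult_mat_vec:
  fixes A :: "real mat"
  shows "A \<in> carrier_mat n m \<Longrightarrow> x \<in> carrier_vec m \<Longrightarrow> (k \<cdot>\<^sub>m A) *\<^sub>v x = k \<cdot>\<^sub>v (A *\<^sub>v x)"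
  by (intro eq_vecI) (auto simp: smult_scalar_prod_distrib[of _ m])

lemma symmetric_scalar_prod_commute:
  fixes A :: "real mat"
  assumes "A \<in> carrier_mat n n" "transpose_mat A = A" "x \<in> carrier_vec n" "y \<in> carrier_vec n"
  shows "scalar_prod x (A *\<^sub>v y) = scalar_prod y (A *\<^sub>v x)"
  using transpose_vec_mult_scalar[OF assms(1,4,3)] assms
  by (simp add: comm_scalar_prod[of y n])

text \<open>A semidefinite form is minimal at \<open>x\<close>, so its derivative there vanishes.
  Concretely, moving from \<open>x\<close> along \<open>y = B x\<close> changes the form by
  \<open>2 * t * b + t\<^sup>2 * c\<close>, with \<open>b\<close> the squared length of
  \<open>y\<close>; this is negative for small negative \<open>t\<close> unless
  \<open>b = 0\<close>.\<close>

lemma psd_kernel: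
  fixes B :: "real mat"
  assumes B: "B \<in> carrier_mat n n" and sym: "transpose_mat B = B"
    and psd: "\<And>y. y \<in> carrier_vec n \<Longrightarrow> quad_form B y \<ge> 0"
    and x: "x \<in> carrier_vec n" "quad_form B x = 0"
  shows "B *\<^sub>v x = 0\<^sub>v n"
proof (rule ccontr)
  define y where "y = B *\<^sub>v x"
  assume "B *\<^sub>v x \<noteq> 0\<^sub>v n"
  have y: "y \<in> carrier_vec n" using B x by (simp add: y_def)
  define b where "b = scalar_prod y y"
  define c where "c = quad_form B y"
  have "b > 0" using scalar_prod_self_pos y \<open>B *\<^sub>v x \<noteq> 0\<^sub>v n\<close> by (simp add: b_def y_def)
  have "c \<ge> 0" using psd[OF y] by (simp add: c_def)
  have xBy: "scalar_prod x (B *\<^sub>v y) = b"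
    using symmetric_scalar_prod_commute[OF B sym x(1) y] by (simp add: b_def y_def)
  have "quad_form B (x + t \<cdot>\<^sub>v y) = 2 * t * b + t\<^sup>2 * c" for t
  proof -
    have By: "B *\<^sub>v y \<in> carrier_vec n" "B *\<^sub>v x \<in> carrier_vec n" using B y x by auto
    have "quad_form B (x + t \<cdot>\<^sub>v y) =
        scalar_prod x (B *\<^sub>v x) + t * scalar_prod x (B *\<^sub>v y) +
        (t * scalar_prod y (B *\<^sub>v x) + t * (t * scalar_prod y (B *\<^sub>v y)))"
      using B x(1) y By
      by (simp add: quad_form_def mult_add_distrib_mat_vec[of _ n n] mult_mat_vec[of _ n n]
          add_scalar_prod_distrib[of _ n] scalar_prod_add_distrib[of _ n] algebra_simps)
    then show ?thesis
      using x(2) xBy by (simp add: quad_form_def b_def c_def y_def power2_eq_square)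
  qed
  \<comment> \<open>The quadratic is minimal at \<open>- b / c\<close>; with \<open>c + 1\<close>
    the denominator stays positive for \<open>c = 0\<close>, and the value is still
    negative.\<close>
  moreover have "quad_form B (x + (- b / (c + 1)) \<cdot>\<^sub>v y) \<ge> 0" using psd x y by auto
  moreover have "2 * (- b / (c + 1)) * b + (- b / (c + 1))\<^sup>2 * c = - (b / (c + 1))\<^sup>2 * (c + 2)"
    using \<open>c \<ge> 0\<close> by (simp add: power2_eq_square divide_simps) (simp add: algebra_simps)
  moreover have "(b / (c + 1))\<^sup>2 * (c + 2) > 0" using \<open>b > 0\<close> \<open>c \<ge> 0\<close> by simp
  ultimately show False by (metis less_le_not_le mult_minus_left neg_0_le_iff_le)
qed

text \<open>The unit sphere of n-dimensional space, with vectors as functions on the naturals that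
  vanish from \<open>n\<close> on: a closed subset of a product of compact intervals and points,
  compact by Tychonoff.\<close>

lemma compact_sphere_nat_fun:
  "compact {f :: nat \<Rightarrow> real. (\<forall>i\<ge>n. f i = 0) \<and> (\<Sum>i<n. (f i)\<^sup>2) = 1}" (is "compact ?S")
proof -
  define X where "X i = (if i < n then {-1..1} else {0::real})" for i :: nat
  have "compactin (product_topology (\<lambda>i. euclidean) UNIV) (PiE UNIV X)"
    by (subst compactin_PiE) (auto simp: X_def)
  then have cpt: "compact (PiE UNIV X)"
    by (simp add: euclidean_product_topology compactin_euclidean_iff)
  have "closed ?S"
  proof -
    have "?S = (\<Inter>i\<in>{n..}. {f. f i = 0}) \<inter> {f. (\<Sum>i<n. (f i)\<^sup>2) = 1}" by auto
    then show ?thesis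
      by (auto intro!: closed_Int closed_INT closed_Collect_eq continuous_on_sum
          continuous_on_power continuous_on_const continuous_on_product_coordinates
          continuous_on_subset[OF continuous_on_product_coordinates])
  qed
  moreover have "?S \<subseteq> PiE UNIV X"
  proof
    fix f assume f: "f \<in> ?S"
    have "\<bar>f i\<bar> \<le> 1" if "i < n" for i
    proof -
      have "(f i)\<^sup>2 \<le> (\<Sum>i<n. (f i)\<^sup>2)" using that by (intro member_le_sum) auto
      then show ?thesis using f by (simp add: abs_square_le_1)
    qed
    then show "f \<in> PiE UNIV X" using f by (auto simp: X_def abs_le_iff minus_le_iff)
  qed
  ultimately have "compact (PiE UNIV X \<inter> ?S)" "PiE UNIV X \<inter> ?S = ?S"
    using compact_Int_closed[OF cpt] by blast+
  then show ?thesis by (simp only:)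
qed

text \<open>Let \<open>k\<close> be the maximum of the Rayleigh quotient over the unit sphere,
  attained at \<open>x\<close>. Then the form of \<open>k \<cdot>\<^sub>m M - A\<close> is positive
  semidefinite and vanishes at \<open>x\<close>, so \<open>psd_kernel\<close> turns maximality into
  the eigenvalue equation.\<close>

lemma generalized_rayleigh_max:
  assumes A: "A \<in> carrier_mat n n" "transpose_mat A = A" and M: "spd_mat n M" and "n > 0"
  obtains k x where "x \<in> carrier_vec n" "x \<noteq> 0\<^sub>v n" "A *\<^sub>v x = k \<cdot>\<^sub>v (M *\<^sub>v x)"
    "\<And>y. y \<in> carrier_vec n \<Longrightarrow> quad_form A y \<le> k * quad_form M y"
proof -
  have M': "M \<in> carrier_mat n n" "transpose_mat M = M"
    "\<And>x. x \<in> carrier_vec n \<Longrightarrow> x \<noteq> 0\<^sub>v n \<Longrightarrow> quad_form M x > 0"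
    using M by (auto simp: spd_mat_def quad_form_def)
  define S where "S = {f :: nat \<Rightarrow> real. (\<forall>i\<ge>n. f i = 0) \<and> (\<Sum>i<n. (f i)\<^sup>2) = 1}"
  have vec_nz: "Matrix.vec n f \<noteq> 0\<^sub>v n" if "f \<in> S" for f
  proof
    assume "Matrix.vec n f = 0\<^sub>v n"
    then have "f i = 0" if "i < n" for i using that by (metis index_vec index_zero_vec(1))
    then show False using \<open>f \<in> S\<close> by (simp add: S_def)
  qed
  have quad_cont: "continuous_on S (\<lambda>f. quad_form B (Matrix.vec n f))"
    if "B \<in> carrier_mat n n" for B
  proof -
    have eq: "quad_form B (Matrix.vec n f) = (\<Sum>i<n. f i * (\<Sum>j<n. B $$ (i, j) * f j))" for f
      using that by (auto simp: quad_form_def scalar_prod_def lessThan_atLeast0)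
    have "continuous_on S (\<lambda>f. f i)" for i
      by (rule continuous_on_subset[OF continuous_on_product_coordinates]) auto
    then show ?thesis
      unfolding eq by (intro continuous_on_sum continuous_on_mult continuous_on_const)
  qed
  define R where "R f = quad_form A (Matrix.vec n f) / quad_form M (Matrix.vec n f)" for f
  have "compact S" unfolding S_def by (rule compact_sphere_nat_fun)
  moreover have "(\<lambda>i. if i = 0 then 1 else 0) \<in> S"
    using \<open>n > 0\<close> by (simp add: S_def if_distrib[of "\<lambda>x. x\<^sup>2"] sum.delta cong: if_cong)
  then have "S \<noteq> {}" by auto
  moreover have "continuous_on S R"
    unfolding R_def using M'(3) vec_nz
    by (intro continuous_on_divide quad_cont A M') force
  ultimately obtain f where f: "f \<in> S" "\<And>g. g \<in> S \<Longrightarrow> R g \<le> R f"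
    using continuous_attains_sup by metis
  define k where "k = R f"
  define x where "x = Matrix.vec n f"
  have x: "x \<in> carrier_vec n" "x \<noteq> 0\<^sub>v n" using vec_nz[OF f(1)] by (auto simp: x_def)
  have le: "quad_form A y \<le> k * quad_form M y" if y: "y \<in> carrier_vec n" for y
  proof (cases "y = 0\<^sub>v n")
    case True
    then show ?thesis using A M' by (simp add: quad_form_def)
  next
    case False
    define r where "r = sqrt (scalar_prod y y)"
    have "r > 0" using scalar_prod_self_pos[OF y False] by (simp add: r_def)
    define g where "g i = (if i < n then y $ i / r else 0)" for i
    have "y = r \<cdot>\<^sub>v Matrix.vec n g" using y \<open>r > 0\<close> by (auto simp: vec_eq_iff g_def)
    have "g \<in> S"
    proof -
      have "(\<Sum>i<n. (g i)\<^sup>2) = (\<Sum>i<n. (y $ i)\<^sup>2) / r\<^sup>2"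
        by (simp add: g_def power_divide sum_divide_distrib)
      also have "\<dots> = 1"
        using scalar_prod_self_pos[OF y False]
        by (simp add: r_def scalar_prod_self_sum[OF y])
      finally show ?thesis by (simp add: S_def g_def)
    qed
    have "R g \<le> k" using f(2)[OF \<open>g \<in> S\<close>] by (simp add: k_def)
    then have "quad_form A (Matrix.vec n g) \<le> k * quad_form M (Matrix.vec n g)"
      using M'(3)[of "Matrix.vec n g"] vec_nz[OF \<open>g \<in> S\<close>] by (simp add: R_def pos_divide_le_eq)
    then show ?thesis
      unfolding \<open>y = r \<cdot>\<^sub>v Matrix.vec n g\<close> using \<open>r > 0\<close> A M'
      by (simp add: quad_form_smult[of _ n])
  qed
  have quad_B: "quad_form (k \<cdot>\<^sub>m M - A) y = k * quad_form M y - quad_form A y"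
    if "y \<in> carrier_vec n" for y
    using A M' that
    by (simp add: quad_form_def minus_mult_distrib_mat_vec[of _ n n] scalar_prod_minus_distrib[of _ n]
        smult_mult_mat_vec[of _ n n])
  have "(k \<cdot>\<^sub>m M - A) *\<^sub>v x = 0\<^sub>v n"
  proof (rule psd_kernel)
    show "transpose_mat (k \<cdot>\<^sub>m M - A) = k \<cdot>\<^sub>m M - A"
    proof (subst transpose_minus[of _ n n])
      have "transpose_mat (k \<cdot>\<^sub>m M) = k \<cdot>\<^sub>m transpose_mat M" by (intro eq_matI) auto
      then show "transpose_mat (k \<cdot>\<^sub>m M) - transpose_mat A = k \<cdot>\<^sub>m M - A" using A M' by simp
    qed (use A M' in auto)
    show "quad_form (k \<cdot>\<^sub>m M - A) x = 0"
    proof -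
      have "k * quad_form M x = quad_form A x"
        using M'(3)[OF x] by (simp add: k_def R_def x_def)
      then show ?thesis by (simp add: quad_B x)
    qed
  qed (use A M' x quad_B le in auto)
  then have "k \<cdot>\<^sub>v (M *\<^sub>v x) - A *\<^sub>v x = 0\<^sub>v n"
    using A M' x by (simp add: minus_mult_distrib_mat_vec[of _ n n] smult_mult_mat_vec[of _ n n])
  then have "A *\<^sub>v x = k \<cdot>\<^sub>v (M *\<^sub>v x)"
    using A M' x by (auto simp: vec_eq_iff)
  then show ?thesis using that x le by blast
qed

text \<open>The product \<open>M_inv * A\<close> is in general not symmetric even for symmetric
  factors; the equation on the right keeps \<open>A\<close> and \<open>M\<close> apart, in the form
  that Rayleigh quotients deliver.\<close>

lemma inverse_mult_eigen_iff:
  fixes M :: "real mat"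
  assumes M: "M \<in> carrier_mat n n" and inv: "M_inv \<in> carrier_mat n n" "inverts_mat M M_inv"
    and A: "A \<in> carrier_mat n n" and x: "x \<in> carrier_vec n"
  shows "(M_inv * A) *\<^sub>v x = k \<cdot>\<^sub>v x \<longleftrightarrow> A *\<^sub>v x = k \<cdot>\<^sub>v (M *\<^sub>v x)"
proof -
  have MI: "M * M_inv = 1\<^sub>m n" using inv M by (simp add: inverts_mat_def)
  then have IM: "M_inv * M = 1\<^sub>m n" using mat_mult_left_right_inverse M inv by blast
  have 1: "M *\<^sub>v (M_inv *\<^sub>v y) = y" "M_inv *\<^sub>v (M *\<^sub>v y) = y" if "y \<in> carrier_vec n" for y
    using assoc_mult_mat_vec[OF M inv(1) that] assoc_mult_mat_vec[OF inv(1) M that] MI IM that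
    by simp_all
  have 2: "(M_inv * A) *\<^sub>v x = M_inv *\<^sub>v (A *\<^sub>v x)" using A inv x by simp
  have Ax: "A *\<^sub>v x \<in> carrier_vec n" "M *\<^sub>v x \<in> carrier_vec n" using A M x by auto
  show ?thesis
  proof
    assume "(M_inv * A) *\<^sub>v x = k \<cdot>\<^sub>v x"
    then have "M *\<^sub>v (M_inv *\<^sub>v (A *\<^sub>v x)) = M *\<^sub>v (k \<cdot>\<^sub>v x)" using 2 by simp
    then show "A *\<^sub>v x = k \<cdot>\<^sub>v (M *\<^sub>v x)" using 1 Ax mult_mat_vec[OF M x] by simp
  next
    assume "A *\<^sub>v x = k \<cdot>\<^sub>v (M *\<^sub>v x)"
    then have "M_inv *\<^sub>v (A *\<^sub>v x) = k \<cdot>\<^sub>v x"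
      using mult_mat_vec[OF inv(1) Ax(2)] 1(2)[OF x] by simp
    then show "(M_inv * A) *\<^sub>v x = k \<cdot>\<^sub>v x" using 2 by simp
  qed
qed

text \<open>The maximal value of the Rayleigh quotient is an eigenvalue, and every eigenvalue is the
  quotient at its eigenvector, so no other is larger. The smallest eigenvalue comes from the same
  argument for \<open>- A\<close>.\<close>

lemma spectrum_extremes:
  fixes A :: "real mat"
  assumes A: "A \<in> carrier_mat n n" "transpose_mat A = A" and M: "spd_mat n M" and "n > 0"
    and inv: "M_inv \<in> carrier_mat n n" "inverts_mat M M_inv"
  obtains x y where
    "x \<in> carrier_vec n" "x \<noteq> 0\<^sub>v n" "quad_form A x = Max (spectrum (M_inv * A)) * quad_form M x"
    "\<And>z. z \<in> carrier_vec n \<Longrightarrow> quad_form A z \<le> Max (spectrum (M_inv * A)) * quad_form M z"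
    "y \<in> carrier_vec n" "y \<noteq> 0\<^sub>v n" "quad_form A y = Min (spectrum (M_inv * A)) * quad_form M y"
    "\<And>z. z \<in> carrier_vec n \<Longrightarrow> quad_form A z \<ge> Min (spectrum (M_inv * A)) * quad_form M z"
proof -
  have M': "M \<in> carrier_mat n n" using M by (simp add: spd_mat_def)
  have pos: "quad_form M z > 0" if "z \<in> carrier_vec n" "z \<noteq> 0\<^sub>v n" for z
    using M that by (simp add: spd_mat_def quad_form_def)
  have spec: "k \<in> spectrum (M_inv * A) \<longleftrightarrow>
      (\<exists>z\<in>carrier_vec n. z \<noteq> 0\<^sub>v n \<and> A *\<^sub>v z = k \<cdot>\<^sub>v (M *\<^sub>v z))" for k
    using inverse_mult_eigen_iff[OF M' inv A(1)] inv A
    by (auto simp: spectrum_def eigenvalue_def eigenvector_def simp del: assoc_mult_mat_vec)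
  have quad_eq: "quad_form A z = k * quad_form M z"
    if "z \<in> carrier_vec n" "A *\<^sub>v z = k \<cdot>\<^sub>v (M *\<^sub>v z)" for z k
    using that M' by (simp add: quad_form_def)
  have fin: "finite (spectrum (M_inv * A))"
    using A inv by (intro card_finite_spectrum(1)[of _ n]) auto
  obtain k x where x: "x \<in> carrier_vec n" "x \<noteq> 0\<^sub>v n" "A *\<^sub>v x = k \<cdot>\<^sub>v (M *\<^sub>v x)"
    "\<And>z. z \<in> carrier_vec n \<Longrightarrow> quad_form A z \<le> k * quad_form M z"
    using generalized_rayleigh_max[OF A M \<open>n > 0\<close>] by blast
  have "Max (spectrum (M_inv * A)) = k"
  proof (rule Max_eqI[OF fin])
    fix k' assume "k' \<in> spectrum (M_inv * A)"
    then obtain z where z: "z \<in> carrier_vec n" "z \<noteq> 0\<^sub>v n" "A *\<^sub>v z = k' \<cdot>\<^sub>v (M *\<^sub>v z)"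
      using spec by blast
    have "k' * quad_form M z \<le> k * quad_form M z"
      using x(4)[OF z(1)] quad_eq[OF z(1,3)] by simp
    then show "k' \<le> k" using pos[OF z(1,2)] by simp
  qed (use x spec in blast)
  obtain l y where y: "y \<in> carrier_vec n" "y \<noteq> 0\<^sub>v n" "- A *\<^sub>v y = l \<cdot>\<^sub>v (M *\<^sub>v y)"
    "\<And>z. z \<in> carrier_vec n \<Longrightarrow> quad_form (- A) z \<le> l * quad_form M z"
  proof -
    have "- A \<in> carrier_mat n n" "transpose_mat (- A) = - A"
      using A by (auto simp: transpose_uminus)
    from generalized_rayleigh_max[OF this M \<open>n > 0\<close>] show ?thesis using that by blast
  qed
  have neg: "- A *\<^sub>v z = - (A *\<^sub>v z)" if "z \<in> carrier_vec n" for z using A that by simp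
  have quad_neg: "quad_form (- A) z = - quad_form A z" if "z \<in> carrier_vec n" for z
    using A that by (simp add: quad_form_def)
  have "A *\<^sub>v y = - l \<cdot>\<^sub>v (M *\<^sub>v y)"
  proof (rule eq_vecI)
    fix i assume "i < dim_vec (- l \<cdot>\<^sub>v (M *\<^sub>v y))"
    then have "i < n" using M' by simp
    then have "vec_index (- (A *\<^sub>v y)) i = vec_index (l \<cdot>\<^sub>v (M *\<^sub>v y)) i"
      using y(3) neg[OF y(1)] by simp
    then show "vec_index (A *\<^sub>v y) i = vec_index (- l \<cdot>\<^sub>v (M *\<^sub>v y)) i"
      using \<open>i < n\<close> A M' by simp
  qed (use A M' in simp)
  then have "Min (spectrum (M_inv * A)) = - l"
  proof (intro Min_eqI[OF fin])
    fix k' assume "k' \<in> spectrum (M_inv * A)"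
    then obtain z where z: "z \<in> carrier_vec n" "z \<noteq> 0\<^sub>v n" "A *\<^sub>v z = k' \<cdot>\<^sub>v (M *\<^sub>v z)"
      using spec by blast
    have "- l * quad_form M z \<le> k' * quad_form M z"
      using y(4)[OF z(1)] quad_eq[OF z(1,3)] quad_neg[OF z(1)] by simp
    then show "- l \<le> k'" using mult_le_cancel_right_pos[OF pos[OF z(1,2)]] by blast
  qed (use y spec in blast)
  show ?thesis
  proof (rule that)
    show "quad_form A z \<ge> Min (spectrum (M_inv * A)) * quad_form M z" if "z \<in> carrier_vec n" for z
      using y(4)[OF that] quad_neg[OF that] \<open>Min _ = - l\<close> by simp
    show "quad_form A y = Min (spectrum (M_inv * A)) * quad_form M y"
      using quad_eq[OF y(1) \<open>A *\<^sub>v y = _\<close>] \<open>Min _ = - l\<close> by simp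
  qed (use x y quad_eq \<open>Max _ = k\<close> in auto)
qed

text \<open>The upper bound, tested at an eigenvector for the largest eigenvalue of
  \<open>M_inv * B\<close>, gives \<open>\<Lambda>' \<le> d * \<Lambda>\<close>; the lower bound,
  tested at one for the smallest, gives \<open>\<mu> \<le> c * \<mu>'\<close>. Positivity of the
  form of \<open>A\<close> makes \<open>\<mu>\<close>, and with it \<open>\<mu>'\<close>, positive,
  so the quotients compare.\<close>

lemma cond_number_le_of_equivalent:
  fixes A B :: "real mat"
  assumes A: "A \<in> carrier_mat n n" "transpose_mat A = A"
    and B: "B \<in> carrier_mat n n" "transpose_mat B = B"
    and M: "spd_mat n M" and "n > 0" and inv: "M_inv \<in> carrier_mat n n" "inverts_mat M M_inv"
    and pos: "\<And>x. x \<in> carrier_vec n \<Longrightarrow> x \<noteq> 0\<^sub>v n \<Longrightarrow> quad_form A x > 0"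
    and upper: "\<And>x. x \<in> carrier_vec n \<Longrightarrow> quad_form B x \<le> d * quad_form A x"
    and lower: "\<And>x. x \<in> carrier_vec n \<Longrightarrow> quad_form A x \<le> c * quad_form B x"
    and "c > 0" "d \<ge> 0"
  shows "cond_number (M_inv * B) \<le> c * d * cond_number (M_inv * A)"
proof -
  have pos_M: "quad_form M z > 0" if "z \<in> carrier_vec n" "z \<noteq> 0\<^sub>v n" for z
    using M that by (simp add: spd_mat_def quad_form_def)
  define \<Lambda> \<mu> \<Lambda>' \<mu>' where "\<Lambda> = Max (spectrum (M_inv * A))" and "\<mu> = Min (spectrum (M_inv * A))"
    and "\<Lambda>' = Max (spectrum (M_inv * B))" and "\<mu>' = Min (spectrum (M_inv * B))"
  obtain y where y: "y \<in> carrier_vec n" "y \<noteq> 0\<^sub>v n" "quad_form A y = \<mu> * quad_form M y"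
    and A_le: "\<And>z. z \<in> carrier_vec n \<Longrightarrow> quad_form A z \<le> \<Lambda> * quad_form M z"
    and A_ge: "\<And>z. z \<in> carrier_vec n \<Longrightarrow> quad_form A z \<ge> \<mu> * quad_form M z"
    using spectrum_extremes[OF A M \<open>n > 0\<close> inv] unfolding \<Lambda>_def \<mu>_def by metis
  obtain x' y' where x': "x' \<in> carrier_vec n" "x' \<noteq> 0\<^sub>v n" "quad_form B x' = \<Lambda>' * quad_form M x'"
    and y': "y' \<in> carrier_vec n" "y' \<noteq> 0\<^sub>v n" "quad_form B y' = \<mu>' * quad_form M y'"
    using spectrum_extremes[OF B M \<open>n > 0\<close> inv] unfolding \<Lambda>'_def \<mu>'_def by metis
  have "\<mu> * quad_form M y > 0" using pos[OF y(1,2)] y(3) by simp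
  then have "\<mu> > 0" using pos_M[OF y(1,2)] by (simp add: zero_less_mult_iff)
  have "\<Lambda> * quad_form M y > 0" using pos[OF y(1,2)] A_le[OF y(1)] by simp
  then have "\<Lambda> > 0" using pos_M[OF y(1,2)] by (simp add: zero_less_mult_iff)
  have "\<Lambda>' * quad_form M x' \<le> d * (\<Lambda> * quad_form M x')"
    using upper[OF x'(1)] mult_left_mono[OF A_le[OF x'(1)] \<open>d \<ge> 0\<close>] x'(3) by simp
  then have "\<Lambda>' * quad_form M x' \<le> (d * \<Lambda>) * quad_form M x'" by simp
  then have \<Lambda>': "\<Lambda>' \<le> d * \<Lambda>"
    using mult_le_cancel_right_pos[OF pos_M[OF x'(1,2)]] by blast
  have "\<mu> * quad_form M y' \<le> c * (\<mu>' * quad_form M y')"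
    using lower[OF y'(1)] A_ge[OF y'(1)] y'(3) by simp
  then have "\<mu> * quad_form M y' \<le> (c * \<mu>') * quad_form M y'" by simp
  then have \<mu>': "\<mu> \<le> c * \<mu>'"
    using mult_le_cancel_right_pos[OF pos_M[OF y'(1,2)]] by blast
  then have "c * \<mu>' > 0" using \<open>\<mu> > 0\<close> by simp
  then have "\<mu>' > 0" using \<open>c > 0\<close> by (simp add: zero_less_mult_iff)
  have "\<Lambda>' / \<mu>' \<le> d * \<Lambda> / \<mu>'" using \<Lambda>' \<open>\<mu>' > 0\<close> by (simp add: divide_right_mono)
  \<comment> \<open>Expanding by \<open>c\<close> creates the denominator \<open>c * \<mu>'\<close>,
    for which \<open>\<mu>\<close> is a lower bound.\<close>
  also have "\<dots> = c * (d * \<Lambda>) / (c * \<mu>')" using \<open>c > 0\<close> by simp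
  also have "\<dots> \<le> c * (d * \<Lambda>) / \<mu>"
    using \<mu>' \<open>\<mu> > 0\<close> \<open>c > 0\<close> \<open>d \<ge> 0\<close> \<open>\<Lambda> > 0\<close> \<open>\<mu>' > 0\<close>
    by (intro divide_left_mono mult_nonneg_nonneg mult_pos_pos) auto
  finally show ?thesis by (simp add: cond_number_def \<Lambda>_def \<mu>_def \<Lambda>'_def \<mu>'_def)
qed

section \<open>Nodal interpolation on a conforming mesh\<close>

text \<open>The vertices are named in order so that barycentric coordinates can be written down;
  distinctness makes them three.\<close>

definition triangle_on :: "(real^2) set \<Rightarrow> real^2 \<Rightarrow> real^2 \<Rightarrow> real^2 \<Rightarrow> bool" where
  "triangle_on e a b c \<longleftrightarrow>
     e = convex hull {a, b, c} \<and> \<not> affine_dependent {a, b, c} \<and> a \<noteq> b \<and> a \<noteq> c \<and> b \<noteq> c"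

text \<open>These two relabellings bring either of the other vertices to the front.\<close>

lemma triangle_on_perm:
  assumes "triangle_on e a b c"
  shows "triangle_on e b a c" "triangle_on e c a b"
  using assms by (auto simp: triangle_on_def insert_commute)

lemma two_simplex_triangle:
  assumes "2 simplex e"
  obtains a b c where "triangle_on e a b c"
proof -
  obtain C where C: "\<not> affine_dependent C" "int (card C) = 3" "e = convex hull C"
    using assms by (auto simp: simplex_def)
  then have "card C = 3" by simp
  then obtain a b c where "C = {a, b, c}" "a \<noteq> b" "a \<noteq> c" "b \<noteq> c"
    by (auto simp: card_3_iff)
  then show ?thesis using that C by (auto simp: triangle_on_def)
qed

lemma triangle_extreme_point:
  assumes "triangle_on e a b c"
  shows "p extreme_point_of e \<longleftrightarrow> p \<in> {a, b, c}"
  using assms extreme_point_of_convex_hull_affine_independent[of "{a, b, c}" p]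
  by (simp add: triangle_on_def)

lemma triangle_vertices_in:
  assumes "triangle_on e a b c"
  shows "a \<in> e" "b \<in> e" "c \<in> e"
  using assms by (auto simp: triangle_on_def intro: hull_inc)

lemma triangle_point:
  assumes "triangle_on e a b c" "x \<in> e"
  obtains \<alpha> \<beta> \<gamma> where "0 \<le> \<alpha>" "0 \<le> \<beta>" "0 \<le> \<gamma>" "\<alpha> + \<beta> + \<gamma> = 1"
    "x = \<alpha> *\<^sub>R a + \<beta> *\<^sub>R b + \<gamma> *\<^sub>R c"
  using assms by (auto simp: triangle_on_def convex_hull_3)

lemma triangle_compact_convex:
  assumes "triangle_on e a b c"
  shows "compact e" "convex e" "closed e"
  using assms by (auto simp: triangle_on_def finite_imp_compact_convex_hull compact_imp_closed)

lemma triangle_interior_nonempty: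
  assumes "triangle_on e a b c"
  shows "interior e \<noteq> {}"
  using assms interior_convex_hull_eq_empty[of "{a, b, c}"] by (auto simp: triangle_on_def)

lemma triangle_aff_dim:
  assumes "triangle_on e a b c"
  shows "aff_dim e = 2"
  using assms aff_dim_affine_independent[of "{a, b, c}"] by (auto simp: triangle_on_def aff_dim_convex_hull)

text \<open>The edge vectors \<open>b - a\<close> and \<open>c - a\<close> are independent, so a
  linear map with the required increments exists; its representing vector is
  \<open>g\<close>.\<close>

lemma affine_interpolation_exists:
  assumes "triangle_on e a b c"
  shows "\<exists>g d. \<forall>p\<in>{a, b, c}. inner g p + d = w p"
proof -
  have "\<not> affine_dependent {a, b, c}" using assms by (simp add: triangle_on_def)
  then have "independent ((\<lambda>x. - a + x) ` ({a, b, c} - {a}))"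
    using affine_dependent_iff_dependent2[of a "{a, b, c}"] by simp
  moreover have "(\<lambda>x. - a + x) ` ({a, b, c} - {a}) = {b - a, c - a}"
    using assms by (auto simp: triangle_on_def)
  ultimately have "independent {b - a, c - a}" by simp
  from linear_independent_extend[OF this, of "\<lambda>x. w (x + a) - w a"]
  obtain f :: "real^2 \<Rightarrow> real" where f: "linear f" "f (b - a) = w b - w a" "f (c - a) = w c - w a"
    by auto
  define g where "g = adjoint f 1"
  have g: "f x = inner g x" for x
    using adjoint_works[OF f(1), of x 1] by (simp add: g_def inner_commute)
  show ?thesis
  proof (intro exI[of _ g] exI[of _ "w a - inner g a"] ballI)
    show "inner g p + (w a - inner g a) = w p" if "p \<in> {a, b, c}" for p
      using that f(2,3) by (auto simp: g inner_diff_right)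
  qed
qed

text \<open>By Minkowski's theorem \<open>F\<close> is the hull of its extreme points, and the set
  where two affine functions agree is convex.\<close>

lemma affine_eq_on_hull:
  fixes F :: "(real^2) set"
  assumes "compact F" "convex F"
    and eq: "\<And>p. p extreme_point_of F \<Longrightarrow> inner g p + c = inner g' p + c'" and "x \<in> F"
  shows "inner g x + c = inner g' x + c'"
proof -
  have "F = convex hull {p. p extreme_point_of F}"
    by (rule Krein_Milman_Minkowski) fact+
  also have "\<dots> \<subseteq> {x. inner (g - g') x = c' - c}"
    using eq by (intro hull_minimal convex_hyperplane) (force simp: inner_diff_left)
  finally show ?thesis using \<open>x \<in> F\<close> by (auto simp: inner_diff_left)
qed

definition interp_coeffs :: "(real^2 \<Rightarrow> real) \<Rightarrow> (real^2) set \<Rightarrow> (real^2) \<times> real" where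
  "interp_coeffs w e = (SOME p. \<forall>q. q extreme_point_of e \<longrightarrow> inner (fst p) q + snd p = w q)"

text \<open>On a conforming mesh the choice of the element containing \<open>x\<close> is
  immaterial, by \<open>interp_on_element\<close>. Extension by zero makes the function total, as
  the Lipschitz estimate on the plane requires.\<close>

definition interp :: "(real^2) set set \<Rightarrow> (real^2 \<Rightarrow> real) \<Rightarrow> real^2 \<Rightarrow> real" where
  "interp \<T> w x =
     (if x \<in> \<Union>\<T>
      then let p = interp_coeffs w (SOME e. e \<in> \<T> \<and> x \<in> e) in inner (fst p) x + snd p
      else 0)"

locale conforming_mesh =
  fixes \<Omega> :: "(real^2) set" and \<T> :: "(real^2) set set"
  assumes domain: "polygonal_domain \<Omega>" and mesh: "mesh_of \<Omega> \<T>"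
begin

section \<open>Elements and interpolants of a conforming mesh\<close>

lemma open_domain: "open \<Omega>" and bounded_domain: "bounded \<Omega>" and
  domain_eq: "interior (closure \<Omega>) = \<Omega>" and domain_nonempty: "\<Omega> \<noteq> {}" and
  connected_domain: "connected \<Omega>"
  using domain by (auto simp: polygonal_domain_def)

lemma finite_mesh: "finite \<T>" and Union_mesh: "\<Union>\<T> = closure \<Omega>"
  using mesh by (auto simp: mesh_of_def triangulation_def)

lemma domain_subset: "\<Omega> \<subseteq> \<Union>\<T>"
  using closure_subset Union_mesh by auto

lemma element_triangle:
  assumes "e \<in> \<T>"
  obtains a b c where "triangle_on e a b c"
proof -
  have "2 simplex e" using assms mesh by (simp add: mesh_of_def)
  then show ?thesis using two_simplex_triangle that by blast
qed

lemma Int_face: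
  assumes "e \<in> \<T>" "e' \<in> \<T>"
  shows "e \<inter> e' face_of e" "e \<inter> e' face_of e'"
proof -
  show "e \<inter> e' face_of e" using assms mesh by (auto simp: mesh_of_def triangulation_def)
  have "e' \<inter> e face_of e'" using assms mesh by (auto simp: mesh_of_def triangulation_def)
  then show "e \<inter> e' face_of e'" by (simp add: Int_commute)
qed

lemma element_closed: "e \<in> \<T> \<Longrightarrow> closed e"
  and element_compact: "e \<in> \<T> \<Longrightarrow> compact e"
  and element_convex: "e \<in> \<T> \<Longrightarrow> convex e"
  using element_triangle triangle_compact_convex by metis+

text \<open>The common part is a face of \<open>e\<close> that meets its interior, hence all of
  \<open>e\<close>. So \<open>e\<close> is a face of \<open>e'\<close>, and a proper face would have
  smaller dimension.\<close>

lemma interior_element_unique: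
  assumes "e \<in> \<T>" "e' \<in> \<T>" "x \<in> interior e" "x \<in> e'"
  shows "e = e'"
proof -
  have "x \<in> (e \<inter> e') \<inter> interior e" using assms interior_subset by auto
  then have "e \<inter> e' = e" using face_of_disjoint_interior[OF Int_face(1)[OF assms(1,2)]] by blast
  then have face: "e face_of e'" using Int_face(2)[OF assms(1,2)] by simp
  show ?thesis
  proof (rule ccontr)
    assume "e \<noteq> e'"
    then have "aff_dim e < aff_dim e'"
      using face_of_aff_dim_lt[OF element_convex[OF assms(2)] face] by blast
    moreover have "aff_dim e = 2" "aff_dim e' = 2"
      using element_triangle triangle_aff_dim assms(1,2) by metis+
    ultimately show False by simp
  qed
qed

lemma interp_coeffs_vertex:
  assumes "e \<in> \<T>" "q extreme_point_of e"
  shows "inner (fst (interp_coeffs w e)) q + snd (interp_coeffs w e) = w q"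
proof -
  obtain a b c where t: "triangle_on e a b c" using element_triangle assms(1) by blast
  obtain g d where "\<forall>p\<in>{a, b, c}. inner g p + d = w p"
    using affine_interpolation_exists[OF t] by blast
  then have "\<exists>p. \<forall>q. q extreme_point_of e \<longrightarrow> inner (fst p) q + snd p = w q"
    using triangle_extreme_point[OF t] by (intro exI[of _ "(g, d)"]) auto
  from someI_ex[OF this] show ?thesis using assms(2) by (simp add: interp_coeffs_def)
qed

text \<open>Two elements containing \<open>x\<close> meet in a common face, whose extreme points are
  vertices of both. There both affine functions take the values of \<open>w\<close>, so they agree
  on the face.\<close>

lemma interp_on_element:
  assumes "e \<in> \<T>" "x \<in> e"
  shows "interp \<T> w x = inner (fst (interp_coeffs w e)) x + snd (interp_coeffs w e)"
proof -
  define e' where "e' = (SOME e. e \<in> \<T> \<and> x \<in> e)"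
  have e': "e' \<in> \<T>" "x \<in> e'" using someI_ex[of "\<lambda>e. e \<in> \<T> \<and> x \<in> e"] assms by (auto simp: e'_def)
  have "inner (fst (interp_coeffs w e)) x + snd (interp_coeffs w e) =
      inner (fst (interp_coeffs w e')) x + snd (interp_coeffs w e')"
  proof (rule affine_eq_on_hull)
    show "compact (e \<inter> e')" "convex (e \<inter> e')"
      using assms e' by (auto simp: compact_Int element_compact convex_Int element_convex)
    fix p assume "p extreme_point_of (e \<inter> e')"
    then have "p extreme_point_of e" "p extreme_point_of e'"
      using extreme_point_of_face Int_face assms(1) e'(1) by metis+
    then show "inner (fst (interp_coeffs w e)) p + snd (interp_coeffs w e) =
      inner (fst (interp_coeffs w e')) p + snd (interp_coeffs w e')"
      using interp_coeffs_vertex assms(1) e'(1) by simp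
  qed (use assms e' in auto)
  moreover have "x \<in> \<Union>\<T>" using assms by auto
  ultimately show ?thesis by (simp add: interp_def e'_def Let_def)
qed

lemma interp_vertex: "e \<in> \<T> \<Longrightarrow> p extreme_point_of e \<Longrightarrow> interp \<T> w p = w p"
  using interp_on_element interp_coeffs_vertex by (simp add: extreme_point_of_def)

lemma interp_barycentric:
  assumes "e \<in> \<T>" "triangle_on e a b c" "0 \<le> \<alpha>" "0 \<le> \<beta>" "0 \<le> \<gamma>" "\<alpha> + \<beta> + \<gamma> = 1"
  shows "interp \<T> w (\<alpha> *\<^sub>R a + \<beta> *\<^sub>R b + \<gamma> *\<^sub>R c) = \<alpha> * w a + \<beta> * w b + \<gamma> * w c"
proof -
  let ?x = "\<alpha> *\<^sub>R a + \<beta> *\<^sub>R b + \<gamma> *\<^sub>R c"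
  let ?g = "fst (interp_coeffs w e)" and ?d = "snd (interp_coeffs w e)"
  have "?x \<in> e" using assms by (auto simp: triangle_on_def convex_hull_3)
  then have "interp \<T> w ?x = inner ?g ?x + (\<alpha> + \<beta> + \<gamma>) * ?d"
    using interp_on_element assms by simp
  also have "\<dots> = \<alpha> * (inner ?g a + ?d) + \<beta> * (inner ?g b + ?d) + \<gamma> * (inner ?g c + ?d)"
    by (simp add: inner_add_right algebra_simps)
  also have "inner ?g a + ?d = w a"
    using interp_coeffs_vertex[OF assms(1)] triangle_extreme_point[OF assms(2)] by blast
  also have "inner ?g b + ?d = w b"
    using interp_coeffs_vertex[OF assms(1)] triangle_extreme_point[OF assms(2)] by blast
  also have "inner ?g c + ?d = w c"
    using interp_coeffs_vertex[OF assms(1)] triangle_extreme_point[OF assms(2)] by blast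
  finally show ?thesis .
qed

lemma interp_in_P1: "e \<in> \<T> \<Longrightarrow> interp \<T> w \<in> P1 e"
  unfolding P1_def using interp_on_element by blast

lemma continuous_on_interp: "continuous_on (closure \<Omega>) (interp \<T> w)"
proof -
  have "continuous_on (\<Union>e\<in>\<T>. e) (interp \<T> w)"
  proof (rule continuous_on_closed_Union)
    fix e assume "e \<in> \<T>"
    have "continuous_on e (\<lambda>x. inner (fst (interp_coeffs w e)) x + snd (interp_coeffs w e))"
      by (intro continuous_on_add continuous_on_inner continuous_on_const continuous_on_id)
    then show "continuous_on e (interp \<T> w)"
      by (rule continuous_on_eq) (simp add: interp_on_element[OF \<open>e \<in> \<T>\<close>])
  qed (auto simp: finite_mesh element_closed)
  then show ?thesis by (simp add: Union_mesh)
qed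

section \<open>Hat functions and the set where they are positive\<close>

definition hat :: "real^2 \<Rightarrow> real^2 \<Rightarrow> real" where
  "hat p = interp \<T> (\<lambda>q. if q = p then 1 else 0)"

lemma hat_barycentric:
  assumes "e \<in> \<T>" "triangle_on e p b c" "0 \<le> \<alpha>" "0 \<le> \<beta>" "0 \<le> \<gamma>" "\<alpha> + \<beta> + \<gamma> = 1"
  shows "hat p (\<alpha> *\<^sub>R p + \<beta> *\<^sub>R b + \<gamma> *\<^sub>R c) = \<alpha>"
proof -
  have "p \<noteq> b" "p \<noteq> c" using assms(2) by (auto simp: triangle_on_def)
  then show ?thesis using interp_barycentric[OF assms] by (simp add: hat_def)
qed

text \<open>On an element without the vertex \<open>p\<close> all three nodal values, and with them
  the interpolant, are 0.\<close>

lemma hat_pos_imp_vertex: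
  assumes "e \<in> \<T>" "x \<in> e" "hat p x > 0"
  obtains b c where "triangle_on e p b c"
proof -
  obtain a b c where t: "triangle_on e a b c" using element_triangle assms(1) by blast
  obtain \<alpha> \<beta> \<gamma> where x: "0 \<le> \<alpha>" "0 \<le> \<beta>" "0 \<le> \<gamma>" "\<alpha> + \<beta> + \<gamma> = 1"
    "x = \<alpha> *\<^sub>R a + \<beta> *\<^sub>R b + \<gamma> *\<^sub>R c"
    using triangle_point[OF t assms(2)] by metis
  have "p \<in> {a, b, c}"
    using interp_barycentric[OF assms(1) t x(1-4), of "\<lambda>q. if q = p then 1 else 0"] assms(3)
    by (auto simp: hat_def x(5) split: if_splits)
  then consider "p = a" | "p = b" | "p = c" by blast
  then show ?thesis
    using that t triangle_on_perm(1,2)[OF t] by cases blast+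
qed

text \<open>
  On a mesh element containing \<open>p\<close>, the dilation with centre \<open>p\<close> acts on \<open>1 - hat p\<close> by scaling.
  Contracting towards \<open>p\<close> moves the point into a small ball around \<open>p\<close> inside the domain, where
  \<open>hat p\<close> is continuous.
\<close>

lemma hat_pos_imp_in_domain:
  assumes "p \<in> \<Omega>" "e \<in> \<T>" "x \<in> e" "hat p x > 0"
  shows "x \<in> \<Omega>"
proof -
  obtain b c where t: "triangle_on e p b c" using hat_pos_imp_vertex assms by blast
  obtain r where r: "r > 0" "ball p r \<subseteq> \<Omega>" using open_domain assms(1) open_contains_ball by blast
  \<comment> \<open>This factor brings the image of \<open>x\<close> closer to \<open>p\<close> than
    \<open>r\<close>; \<open>+ 1\<close> avoids division by zero when \<open>x = p\<close>.\<close>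
  define s where "s = min 1 (r / (2 * (norm (x - p) + 1)))"
  have s: "0 < s" "s \<le> 1"
    using r(1) norm_ge_zero[of "x - p"] by (auto simp: s_def intro!: divide_pos_pos add_nonneg_pos)
  define D where "D y = p + s *\<^sub>R (y - p)" for y
  have continuous_on_D: "continuous_on UNIV D"
    unfolding D_def by (intro continuous_intros)
  have "s * norm (x - p) < r"
  proof -
    have "s * norm (x - p) \<le> r / (2 * (norm (x - p) + 1)) * norm (x - p)"
      by (intro mult_right_mono) (auto simp: s_def)
    also have "\<dots> < r"
      using r(1) norm_ge_zero[of "x - p"] by (simp add: divide_simps add_nonneg_pos add_pos_nonneg)
    finally show ?thesis .
  qed
  then have "D x \<in> ball p r" using s by (simp add: D_def dist_norm)
  moreover have "hat p (D x) > 1 - s"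
  proof -
    obtain \<alpha> \<beta> \<gamma> where x: "0 \<le> \<alpha>" "0 \<le> \<beta>" "0 \<le> \<gamma>" "\<alpha> + \<beta> + \<gamma> = 1"
      "x = \<alpha> *\<^sub>R p + \<beta> *\<^sub>R b + \<gamma> *\<^sub>R c"
      using triangle_point[OF t assms(3)] by metis
    have "\<alpha> > 0" using hat_barycentric[OF assms(2) t x(1-4)] assms(4) x(5) by simp
    have "D x = (1 - s + s * \<alpha>) *\<^sub>R p + (s * \<beta>) *\<^sub>R b + (s * \<gamma>) *\<^sub>R c"
      by (simp add: D_def x(5) algebra_simps)
    moreover have "1 - s + s * \<alpha> + s * \<beta> + s * \<gamma> = 1"
    proof -
      have "s * \<alpha> + s * \<beta> + s * \<gamma> = s * (\<alpha> + \<beta> + \<gamma>)" by (simp add: distrib_left)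
      then show ?thesis using x(4) by simp
    qed
    ultimately have "hat p (D x) = 1 - s + s * \<alpha>"
      using hat_barycentric[OF assms(2) t] x s by simp
    then show ?thesis using s \<open>\<alpha> > 0\<close> by simp
  qed
  ultimately have "x \<in> D -` (ball p r \<inter> hat p -` {1 - s<..})" by simp
  moreover have "open (D -` (ball p r \<inter> hat p -` {1 - s<..}))"
  proof (rule open_vimage[OF _ continuous_on_D])
    show "open (ball p r \<inter> hat p -` {1 - s<..})"
      using r(2) closure_subset unfolding hat_def
      by (intro continuous_open_preimage continuous_on_subset[OF continuous_on_interp]) auto
  qed
  \<comment> \<open>For \<open>y\<close> in this set, undoing the contraction divides the
    coordinates of \<open>D y\<close> at \<open>b'\<close> and \<open>c'\<close> by
    \<open>s\<close>. The coordinate at \<open>p\<close> stays nonnegative because it exceeds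
    \<open>1 - s\<close> before, so \<open>y\<close> remains in the same element.\<close>
  moreover have "D -` (ball p r \<inter> hat p -` {1 - s<..}) \<subseteq> closure \<Omega>"
  proof
    fix y assume "y \<in> D -` (ball p r \<inter> hat p -` {1 - s<..})"
    then have y: "D y \<in> \<Omega>" "hat p (D y) > 1 - s" using r(2) by auto
    then obtain e' where e': "e' \<in> \<T>" "D y \<in> e'" using domain_subset by auto
    have "hat p (D y) > 0" using y(2) s by simp
    then obtain b' c' where t': "triangle_on e' p b' c'" using hat_pos_imp_vertex e' by blast
    obtain \<alpha> \<beta> \<gamma> where z: "0 \<le> \<alpha>" "0 \<le> \<beta>" "0 \<le> \<gamma>" "\<alpha> + \<beta> + \<gamma> = 1"
      "D y = \<alpha> *\<^sub>R p + \<beta> *\<^sub>R b' + \<gamma> *\<^sub>R c'"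
      using triangle_point[OF t' e'(2)] by metis
    have "\<alpha> > 1 - s" using hat_barycentric[OF e'(1) t' z(1-4)] y(2) z(5) by simp
    have "y = p + (1 / s) *\<^sub>R (D y - p)" using s by (simp add: D_def)
    also have "\<dots> = (1 - (1 - \<alpha>) / s) *\<^sub>R p + (\<beta> / s) *\<^sub>R b' + (\<gamma> / s) *\<^sub>R c'"
      unfolding z(5) by (simp add: algebra_simps diff_divide_distrib)
    finally have "y = \<dots>" .
    moreover have "0 \<le> 1 - (1 - \<alpha>) / s" using \<open>\<alpha> > 1 - s\<close> s by (simp add: divide_simps)
    moreover have "(1 - (1 - \<alpha>) / s) + \<beta> / s + \<gamma> / s = 1"
      using z(4) s by (simp add: divide_simps)
    moreover have "0 \<le> \<beta> / s" "0 \<le> \<gamma> / s" using z s by auto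
    ultimately have "y \<in> convex hull {p, b', c'}" unfolding convex_hull_3 by blast
    then have "y \<in> e'" using t' by (simp add: triangle_on_def)
    then show "y \<in> closure \<Omega>" using e'(1) Union_mesh by blast
  qed
  \<comment> \<open>An open neighbourhood of \<open>x\<close> lies in the closure of \<Omega>. Here
    it matters that \<Omega> is the interior of its closure: \<open>x\<close> cannot sit on a
    slit.\<close>
  ultimately have "x \<in> interior (closure \<Omega>)"
    using interior_maximal[of "D -` (ball p r \<inter> hat p -` {1 - s<..})" "closure \<Omega>"] by blast
  then show ?thesis using domain_eq by simp
qed

text \<open>The barycentric coordinates of \<open>x\<close> in its element are the values of three
  hat functions. At a vertex inside \<Omega> this value must be 0, since otherwise \<open>x\<close>
  would lie in \<Omega>; at the other vertices \<open>w\<close> is 0.\<close>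

lemma interp_zero_outside:
  assumes w: "\<And>p. p \<notin> \<Omega> \<Longrightarrow> w p = 0" and "x \<notin> \<Omega>"
  shows "interp \<T> w x = 0"
proof (cases "x \<in> \<Union>\<T>")
  case True
  then obtain e where e: "e \<in> \<T>" "x \<in> e" by blast
  obtain a b c where t: "triangle_on e a b c" using element_triangle e(1) by blast
  obtain \<alpha> \<beta> \<gamma> where x: "0 \<le> \<alpha>" "0 \<le> \<beta>" "0 \<le> \<gamma>" "\<alpha> + \<beta> + \<gamma> = 1"
    "x = \<alpha> *\<^sub>R a + \<beta> *\<^sub>R b + \<gamma> *\<^sub>R c"
    using triangle_point[OF t e(2)] by metis
  have zero: "s * w p = 0" if "s \<ge> 0" "hat p x = s" for s p
    using hat_pos_imp_in_domain[OF _ e, of p] that assms by (cases "p \<in> \<Omega>") fastforce+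
  have "hat a x = \<alpha>" using hat_barycentric[OF e(1) t x(1-4)] x(5) by simp
  moreover have "hat b x = \<beta>"
    using hat_barycentric[OF e(1) triangle_on_perm(1)[OF t], of \<beta> \<alpha> \<gamma>] x by (simp add: algebra_simps)
  moreover have "hat c x = \<gamma>"
    using hat_barycentric[OF e(1) triangle_on_perm(2)[OF t], of \<gamma> \<alpha> \<beta>] x by (simp add: algebra_simps)
  ultimately show ?thesis
    using interp_barycentric[OF e(1) t x(1-4), of w] zero x by simp
qed (simp add: interp_def)

text \<open>A segment between two points may leave \<Omega> and return. Its parameter interval is
  therefore covered by finitely many closed pieces, the preimages of the elements and of the
  complement of \<Omega>; the bound holds on each and hence along the whole segment.\<close>

lemma lipschitz_interp:
  assumes w: "\<And>p. p \<notin> \<Omega> \<Longrightarrow> w p = 0"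
  shows "\<exists>L. L-lipschitz_on UNIV (interp \<T> w)"
proof
  define L where "L = (\<Sum>e\<in>\<T>. norm (fst (interp_coeffs w e)))"
  have L: "L \<ge> 0" by (auto simp: L_def intro: sum_nonneg)
  have le_L: "norm (fst (interp_coeffs w e)) \<le> L" if "e \<in> \<T>" for e
    unfolding L_def using finite_mesh that by (intro member_le_sum) auto
  show "L-lipschitz_on UNIV (interp \<T> w)"
  proof (rule lipschitz_onI)
    fix x y :: "real^2"
    define \<gamma> where "\<gamma> s = x + s *\<^sub>R (y - x)" for s :: real
    have "(L * dist x y)-lipschitz_on {0..1} (\<lambda>s. interp \<T> w (\<gamma> s))"
    proof (rule lipschitz_on_closed_Union[where I="insert (- \<Omega>) \<T>" and U="\<lambda>A. \<gamma> -` A"])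
      fix A assume A: "A \<in> insert (- \<Omega>) \<T>"
      have "closed A" using A element_closed open_domain by auto
      then show "closed (\<gamma> -` A)"
        unfolding \<gamma>_def by (intro continuous_closed_vimage) (auto intro!: continuous_intros)
      show "(L * dist x y)-lipschitz_on (\<gamma> -` A) (\<lambda>s. interp \<T> w (\<gamma> s))"
      proof (rule lipschitz_onI)
        fix s t assume st: "s \<in> \<gamma> -` A" "t \<in> \<gamma> -` A"
        show "dist (interp \<T> w (\<gamma> s)) (interp \<T> w (\<gamma> t)) \<le> L * dist x y * dist s t"
        proof (cases "A \<in> \<T>")
          case True
          have "interp \<T> w (\<gamma> s) - interp \<T> w (\<gamma> t) =
              inner (fst (interp_coeffs w A)) ((s - t) *\<^sub>R (y - x))"
            using st True by (simp add: interp_on_element \<gamma>_def inner_add_right inner_diff_right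
                algebra_simps)
          also have "\<bar>\<dots>\<bar> \<le> norm (fst (interp_coeffs w A)) * norm ((s - t) *\<^sub>R (y - x))"
            by (rule Cauchy_Schwarz_ineq2)
          also have "\<dots> \<le> L * norm ((s - t) *\<^sub>R (y - x))"
            by (intro mult_right_mono le_L True norm_ge_zero)
          finally show ?thesis by (simp add: dist_real_def dist_norm norm_minus_commute mult_ac)
        next
          case False
          then have "A = - \<Omega>" using A by simp
          then have "interp \<T> w (\<gamma> s) = 0" "interp \<T> w (\<gamma> t) = 0"
            using interp_zero_outside[of w] w st by auto
          then show ?thesis using L by simp
        qed
      qed (use L in auto)
    next
      show "{0..1} \<subseteq> (\<Union>A\<in>insert (- \<Omega>) \<T>. \<gamma> -` A)" using domain_subset by auto
    qed (use L finite_mesh in auto)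
    from lipschitz_onD[OF this, of 0 1]
    show "dist (interp \<T> w x) (interp \<T> w y) \<le> L * dist x y" by (simp add: \<gamma>_def)
  qed (rule L)
qed

lemma interp_in_V_h:
  assumes w: "\<And>p. p \<notin> \<Omega> \<Longrightarrow> w p = 0"
  shows "interp \<T> w \<in> V_h \<Omega> \<T>"
proof -
  obtain L where "L-lipschitz_on UNIV (interp \<T> w)" using lipschitz_interp[of w] w by blast
  then have "interp \<T> w \<in> H1_0 \<Omega>"
    using finite_mesh element_convex domain_subset interp_in_P1 interp_zero_outside[of w] w
    by (intro lipschitz_piecewise_affine_in_H1_0[OF open_domain bounded_domain]) auto
  then show ?thesis using interp_in_P1 by (auto simp: V_h_def)
qed

end

section \<open>Edges, sub-triangles and areas\<close>

text \<open>Integrability and value are inherited from the simple function by spiking on a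
  negligible set, so unspecified gradients on the mesh edges do no harm.\<close>

lemma set_integral_eq_sum_indicators:
  fixes f :: "real^2 \<Rightarrow> real"
  assumes "finite I" and meas: "\<And>i. i \<in> I \<Longrightarrow> A i \<in> lmeasurable" and "negligible N"
    and eq: "\<And>x. x \<notin> N \<Longrightarrow> indicator \<Omega> x * f x = (\<Sum>i\<in>I. indicator (A i) x * c i)"
  shows "(LINT x:\<Omega>|lebesgue. f x) = (\<Sum>i\<in>I. measure lebesgue (A i) * c i)"
proof -
  define g where "g x = (\<Sum>i\<in>I. indicator (A i) x * c i)" for x
  have int_i: "integrable lebesgue (\<lambda>x. indicator (A i) x * c i)" if "i \<in> I" for i
    using meas[OF that] by (intro integrable_mult_left integrable_real_indicator)
      (auto simp: fmeasurable_def)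
  have int_g: "integrable lebesgue g"
    unfolding g_def using int_i by (rule Bochner_Integration.integrable_sum)
  then have abs_g: "g absolutely_integrable_on UNIV" by (simp add: set_integrable_def)
  have spike: "indicator \<Omega> x * f x = g x" if "x \<in> UNIV - N" for x using eq that by (simp add: g_def)
  have abs_f: "(\<lambda>x. indicator \<Omega> x * f x) absolutely_integrable_on UNIV"
    by (rule absolutely_integrable_spike[OF abs_g \<open>negligible N\<close> spike])
  have "(LINT x:\<Omega>|lebesgue. f x) = (LINT x:UNIV|lebesgue. indicator \<Omega> x * f x)"
    by (simp add: set_lebesgue_integral_def)
  also have "\<dots> = integral UNIV (\<lambda>x. indicator \<Omega> x * f x)"
    by (rule set_lebesgue_integral_eq_integral(2)[OF abs_f])
  also have "\<dots> = integral UNIV g"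
    by (rule integral_spike[OF \<open>negligible N\<close>]) (use spike in auto)
  also have "\<dots> = (LINT x|lebesgue. g x)"
    using set_lebesgue_integral_eq_integral(2)[OF abs_g] by (simp add: set_lebesgue_integral_def)
  also have "\<dots> = (\<Sum>i\<in>I. LINT x|lebesgue. indicator (A i) x * c i)"
    unfolding g_def using int_i by (rule Bochner_Integration.integral_sum)
  also have "\<dots> = (\<Sum>i\<in>I. measure lebesgue (A i) * c i)"
    by (rule sum.cong) (auto simp: Int_absorb2)
  finally show ?thesis .
qed

text \<open>The faces of a simplex are the hulls of the subsets of its vertices, and dimension 1
  singles out the pairs.\<close>

lemma triangle_edge_iff:
  assumes "triangle_on e a b c"
  shows "l edge_of e \<longleftrightarrow> l \<in> {convex hull {b, c}, convex hull {a, c}, convex hull {a, b}}"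
proof -
  have ind: "\<not> affine_dependent {a, b, c}" and ne: "a \<noteq> b" "a \<noteq> c" "b \<noteq> c"
    and e: "e = convex hull {a, b, c}"
    using assms by (auto simp: triangle_on_def)
  have face: "l face_of e \<longleftrightarrow> (\<exists>C. C \<subseteq> {a, b, c} \<and> l = convex hull C)" for l
    unfolding e by (rule face_of_convex_hull_affine_independent[OF ind])
  have dim: "aff_dim (convex hull C) = int (card C) - 1" if "C \<subseteq> {a, b, c}" for C
    using aff_dim_affine_independent[OF affine_independent_subset[OF ind that]]
    by (simp add: aff_dim_convex_hull)
  show ?thesis
  proof
    assume "l edge_of e"
    then obtain C where C: "C \<subseteq> {a, b, c}" "l = convex hull C" "aff_dim l = 1"
      by (auto simp: edge_of_def face)
    then have "card C = 2" using dim by fastforce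
    then obtain x y where "C = {x, y}" "x \<noteq> y" by (auto simp: card_2_iff)
    then have "C = {b, c} \<or> C = {a, c} \<or> C = {a, b}" using C(1) by blast
    then show "l \<in> {convex hull {b, c}, convex hull {a, c}, convex hull {a, b}}" using C(2) by blast
  next
    have edge: "convex hull {x, y} edge_of e" if "{x, y} \<subseteq> {a, b, c}" "x \<noteq> y" for x y
    proof -
      have "aff_dim (convex hull {x, y}) = 1" using dim[OF that(1)] that(2) by simp
      then show ?thesis unfolding edge_of_def face using that(1) by blast
    qed
    assume "l \<in> {convex hull {b, c}, convex hull {a, c}, convex hull {a, b}}"
    then show "l edge_of e" using edge ne by auto
  qed
qed

text \<open>A segment determines its endpoints, as its extreme points.\<close>

lemma triangle_edges_distinct:
  assumes "triangle_on e a b c"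
  shows "convex hull {b, c} \<noteq> convex hull {a, c}" "convex hull {b, c} \<noteq> convex hull {a, b}"
    "convex hull {a, c} \<noteq> convex hull {a, b}"
proof -
  have ne: "a \<noteq> b" "a \<noteq> c" "b \<noteq> c" using assms by (auto simp: triangle_on_def)
  have hull_eqD: "{x, y} = {x', y'}" if "convex hull {x, y} = convex hull {x', y'}"
    for x y x' y' :: "real^2"
    using extreme_point_of_convex_hull_2[of _ x y] extreme_point_of_convex_hull_2[of _ x' y'] that
    by auto
  show "convex hull {b, c} \<noteq> convex hull {a, c}" "convex hull {b, c} \<noteq> convex hull {a, b}"
    "convex hull {a, c} \<noteq> convex hull {a, b}"
    using hull_eqD[of b c a c] hull_eqD[of b c a b] hull_eqD[of a c a b] ne
    by (auto simp: doubleton_eq_iff)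
qed

lemma triangle_card_edges:
  assumes "triangle_on e a b c"
  shows "finite {l. l edge_of e}" "card {l. l edge_of e} = 3"
proof -
  have "{l. l edge_of e} = {convex hull {b, c}, convex hull {a, c}, convex hull {a, b}}"
    using triangle_edge_iff[OF assms] by blast
  then show "finite {l. l edge_of e}" "card {l. l edge_of e} = 3"
    using triangle_edges_distinct[OF assms] by auto
qed

lemma triangle_edge_opposite:
  assumes "triangle_on e a b c" "l edge_of e"
  obtains a' b' c' where "triangle_on e a' b' c'" "l = convex hull {b', c'}"
proof -
  consider "l = convex hull {b, c}" | "l = convex hull {a, c}" | "l = convex hull {a, b}"
    using assms triangle_edge_iff[OF assms(1)] by blast
  then show ?thesis
    by cases (use that assms(1) triangle_on_perm(1,2)[OF assms(1)] in blast)+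
qed

text \<open>Two different edges share one vertex; it is labelled \<open>c'\<close>, for later use as
  the endpoint of the median separating their sub-triangles.\<close>

lemma triangle_edge_pair:
  assumes "triangle_on e a b c" "l edge_of e" "l' edge_of e" "l \<noteq> l'"
  obtains a' b' c' where "triangle_on e a' b' c'" "l = convex hull {b', c'}" "l' = convex hull {a', c'}"
proof -
  obtain a' b' c' where t: "triangle_on e a' b' c'" "l = convex hull {b', c'}"
    using triangle_edge_opposite assms by blast
  then consider "l' = convex hull {a', c'}" | "l' = convex hull {a', b'}"
    using triangle_edge_iff[OF t(1)] assms(3,4) by blast
  then show ?thesis
  proof cases
    case 1
    then show ?thesis using t that by blast
  next
    case 2
    moreover have "triangle_on e a' c' b'" using t(1) by (auto simp: triangle_on_def insert_commute)
    ultimately show ?thesis using t(2) that[of a' c' b'] by (simp add: insert_commute)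
  qed
qed

section \<open>The three sub-triangles of an element\<close>

definition sub_triangle :: "(real^2) set \<Rightarrow> (real^2) set \<Rightarrow> (real^2) set" where
  "sub_triangle e l = convex hull (insert (barycenter e) l)"

lemma triangle_barycenter:
  assumes "triangle_on e a b c"
  shows "barycenter e = (1/3) *\<^sub>R (a + b + c)"
proof -
  have "{p. p extreme_point_of e} = {a, b, c}" using triangle_extreme_point[OF assms] by blast
  then show ?thesis
    using assms by (simp add: barycenter_def triangle_on_def add.assoc)
qed

lemma sub_triangle_hull:
  assumes "l = convex hull {b, c}"
  shows "sub_triangle e l = convex hull {barycenter e, b, c}"
  unfolding sub_triangle_def assms using hull_insert[of convex "barycenter e" "{b, c}"] by simp

lemma sub_triangle_subset:
  assumes "triangle_on e a b c" "l edge_of e"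
  shows "sub_triangle e l \<subseteq> e"
proof -
  have "barycenter e = (1/3) *\<^sub>R a + (1/3) *\<^sub>R b + (1/3) *\<^sub>R c"
    using triangle_barycenter[OF assms(1)] by (simp add: scaleR_add_right)
  then have "barycenter e \<in> convex hull {a, b, c}"
    unfolding convex_hull_3 by (intro CollectI exI[of _ "1/3"]) auto
  then have "barycenter e \<in> e" using assms(1) by (simp add: triangle_on_def)
  moreover have "l \<subseteq> e" using assms(2) edge_of_imp_subset by blast
  ultimately show ?thesis
    unfolding sub_triangle_def using triangle_compact_convex[OF assms(1)]
    by (intro hull_minimal) auto
qed

lemma compact_sub_triangle:
  assumes "triangle_on e a b c" "l edge_of e"
  shows "compact (sub_triangle e l)"
proof -
  obtain a' b' c' where "l = convex hull {b', c'}" using triangle_edge_opposite assms by blast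
  then show ?thesis by (simp add: sub_triangle_hull finite_imp_compact_convex_hull)
qed

lemma measure_triangle:
  fixes A B C :: "real^2"
  defines "p \<equiv> vec_nth (B - A)" and "q \<equiv> vec_nth (C - A)"
  shows "measure lebesgue (convex hull {A, B, C}) = \<bar>q 1 * p 2 - p 1 * q 2\<bar> / 2"
proof -
  have "closed (convex hull {A, B, C})"
    by (simp add: finite_imp_compact_convex_hull compact_imp_closed)
  then show ?thesis by (simp add: content_triangle p_def q_def)
qed

lemma measure_sub_triangle:
  assumes "triangle_on e a b c" "l edge_of e"
  shows "measure lebesgue (sub_triangle e l) = measure lebesgue e / 3"
proof -
  obtain a' b' c' where t: "triangle_on e a' b' c'" "l = convex hull {b', c'}"
    using triangle_edge_opposite assms by blast
  have e: "e = convex hull {a', b', c'}" using t(1) by (simp add: triangle_on_def)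
  \<comment> \<open>Relative to \<open>a'\<close>, the barycenter is a third of the sum of the edge
    vectors \<open>p\<close> and \<open>q\<close>; the determinant of the sub-triangle then comes
    out as a third of that of \<open>e\<close>.\<close>
  define p q where "p = vec_nth (b' - a')" and "q = vec_nth (c' - a')"
  have "vec_nth (c' - barycenter e) i = (2 * q i - p i) / 3"
    "vec_nth (b' - barycenter e) i = (2 * p i - q i) / 3" for i
    unfolding triangle_barycenter[OF t(1)] p_def q_def
      vector_minus_component vector_scaleR_component vector_add_component real_scaleR_def
    by (simp_all add: algebra_simps)
  moreover have "(2 * q1 - p1) / 3 * ((2 * p2 - q2) / 3) - (2 * p1 - q1) / 3 * ((2 * q2 - p2) / 3)
      = (q1 * p2 - p1 * q2) / 3" for p1 p2 q1 q2 :: real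
    by (simp add: field_simps)
  ultimately have "measure lebesgue (sub_triangle e l) = \<bar>(q 1 * p 2 - p 1 * q 2) / 3\<bar> / 2"
    unfolding sub_triangle_hull[OF t(2)] measure_triangle by (simp only:)
  then show ?thesis unfolding e measure_triangle by (simp add: p_def q_def)
qed

text \<open>If the smallest barycentric coordinate \<alpha> is that of \<open>a\<close>, then
  \<open>x\<close> has coordinates \<open>3 * \<alpha>\<close>, \<open>\<beta> - \<alpha>\<close>
  and \<open>\<gamma> - \<alpha>\<close> with respect to the barycenter, \<open>b\<close> and
  \<open>c\<close>, so it lies in the sub-triangle opposite to \<open>a\<close>.\<close>

lemma sub_triangle_cover:
  assumes "triangle_on e a b c" "x \<in> e"
  obtains l where "l edge_of e" "x \<in> sub_triangle e l"
proof -
  have main: "\<exists>l. l edge_of e \<and> x \<in> sub_triangle e l"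
    if t: "triangle_on e a b c" and x: "x = \<alpha> *\<^sub>R a + \<beta> *\<^sub>R b + \<gamma> *\<^sub>R c"
      and "0 \<le> \<alpha>" "\<alpha> \<le> \<beta>" "\<alpha> \<le> \<gamma>" "\<alpha> + \<beta> + \<gamma> = 1" for a b c \<alpha> \<beta> \<gamma>
  proof (intro exI conjI)
    show "convex hull {b, c} edge_of e" using triangle_edge_iff[OF t] by blast
    have "x = (3 * \<alpha>) *\<^sub>R barycenter e + (\<beta> - \<alpha>) *\<^sub>R b + (\<gamma> - \<alpha>) *\<^sub>R c"
      by (simp add: triangle_barycenter[OF t] x algebra_simps)
    moreover have "3 * \<alpha> + (\<beta> - \<alpha>) + (\<gamma> - \<alpha>) = 1" using that by simp
    moreover have "0 \<le> 3 * \<alpha>" "0 \<le> \<beta> - \<alpha>" "0 \<le> \<gamma> - \<alpha>" using that by auto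
    ultimately show "x \<in> sub_triangle e (convex hull {b, c})"
      unfolding sub_triangle_hull[OF refl] convex_hull_3 by blast
  qed
  obtain \<alpha> \<beta> \<gamma> where x: "0 \<le> \<alpha>" "0 \<le> \<beta>" "0 \<le> \<gamma>" "\<alpha> + \<beta> + \<gamma> = 1"
    "x = \<alpha> *\<^sub>R a + \<beta> *\<^sub>R b + \<gamma> *\<^sub>R c"
    using triangle_point[OF assms] by metis
  consider "\<alpha> \<le> \<beta>" "\<alpha> \<le> \<gamma>" | "\<beta> \<le> \<alpha>" "\<beta> \<le> \<gamma>" | "\<gamma> \<le> \<alpha>" "\<gamma> \<le> \<beta>" by linarith
  then have "\<exists>l. l edge_of e \<and> x \<in> sub_triangle e l"
  proof cases
    case 1
    then show ?thesis using main[OF assms(1)] x by blast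
  next
    case 2
    then show ?thesis
      using main[OF triangle_on_perm(1)[OF assms(1)], of \<beta> \<alpha> \<gamma>] x by (simp add: algebra_simps)
  next
    case 3
    then show ?thesis
      using main[OF triangle_on_perm(2)[OF assms(1)], of \<gamma> \<alpha> \<beta>] x by (simp add: algebra_simps)
  qed
  then show ?thesis using that by blast
qed

text \<open>The median through the common vertex of the two edges separates the sub-triangles, so
  they meet only on a line.\<close>

lemma negligible_sub_triangle_Int:
  assumes "triangle_on e a b c" "l edge_of e" "l' edge_of e" "l \<noteq> l'"
  shows "negligible (sub_triangle e l \<inter> sub_triangle e l')"
proof -
  obtain a' b' c' where t: "triangle_on e a' b' c'"
    and l: "l = convex hull {b', c'}" "l' = convex hull {a', c'}"
    using triangle_edge_pair[OF assms] by blast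
  have ne: "a' \<noteq> b'" "a' \<noteq> c'" "b' \<noteq> c'" using t by (auto simp: triangle_on_def)
  \<comment> \<open>An affine function with values 1, -1 and 0 at the vertices also vanishes at the
    barycenter; its zero line is the median through \<open>c'\<close>.\<close>
  obtain g d where "\<forall>p\<in>{a', b', c'}. inner g p + d = (if p = a' then 1 else if p = b' then - 1 else 0)"
    using affine_interpolation_exists[OF t, of "\<lambda>p. if p = a' then 1 else if p = b' then - 1 else 0"]
    by blast
  then have gd: "inner g a' + d = 1" "inner g b' + d = - 1" "inner g c' + d = 0"
    using ne by auto
  have "inner g (barycenter e) + d = ((inner g a' + d) + (inner g b' + d) + (inner g c' + d)) / 3"
    by (simp add: triangle_barycenter[OF t] inner_add_right)
  then have bary: "inner g (barycenter e) = - d" using gd by simp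
  have "sub_triangle e l \<subseteq> {x. inner g x \<le> - d}"
    unfolding sub_triangle_hull[OF l(1)] using gd bary
    by (intro hull_minimal convex_halfspace_le) auto
  moreover have "sub_triangle e l' \<subseteq> {x. inner g x \<ge> - d}"
    unfolding sub_triangle_hull[OF l(2)] using gd bary
    by (intro hull_minimal convex_halfspace_ge) auto
  ultimately have "sub_triangle e l \<inter> sub_triangle e l' \<subseteq> {x. inner g x = - d}" by fastforce
  moreover have "g \<noteq> 0" using gd by auto
  then have "negligible {x. inner g x = - d}" by (intro negligible_hyperplane) auto
  ultimately show ?thesis using negligible_subset by blast
qed

lemma elem_grad_eq:
  assumes "interior e \<noteq> {}" and u: "\<And>x. x \<in> e \<Longrightarrow> u x = inner g x + c"
  shows "elem_grad u e = g"
  unfolding elem_grad_def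
proof (rule the_equality)
  show "\<exists>c. \<forall>x\<in>e. u x = inner g x + c" using u by blast
  fix g' assume "\<exists>c. \<forall>x\<in>e. u x = inner g' x + c"
  then obtain c' where u': "\<And>x. x \<in> e \<Longrightarrow> u x = inner g' x + c'" by blast
  obtain x r where x: "r > 0" "ball x r \<subseteq> e" using assms(1) mem_interior by blast
  \<comment> \<open>The step length \<open>t\<close> keeps the test point
    \<open>x + t *\<^sub>R (g' - g)\<close> in the ball; the summand 1 keeps \<open>t\<close>
    defined when \<open>g' = g\<close>.\<close>
  define m where "m = norm (g' - g) + 1"
  have m: "m > 0" "norm (g' - g) < m" by (auto simp: m_def add_nonneg_pos)
  define t where "t = r / m"
  have "t > 0" using x(1) m by (simp add: t_def)
  have "norm (t *\<^sub>R (g' - g)) < r"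
  proof -
    have "t * norm (g' - g) < t * m" using m(2) \<open>t > 0\<close> by (rule mult_strict_left_mono)
    then show ?thesis using \<open>t > 0\<close> m(1) x(1) by (simp add: t_def)
  qed
  then have "x + t *\<^sub>R (g' - g) \<in> e" "x \<in> e" using x by (auto simp: dist_norm subset_eq)
  then have "inner g' x + c' = inner g x + c"
    "inner g' (x + t *\<^sub>R (g' - g)) + c' = inner g (x + t *\<^sub>R (g' - g)) + c"
    using u u' by metis+
  then have "t * inner g' (g' - g) = t * inner g (g' - g)"
    unfolding inner_add_right inner_scaleR_right by linarith
  then have "inner (g' - g) (g' - g) = 0" using \<open>t > 0\<close> by (simp add: inner_diff_left)
  then show "g' = g" by simp
qed

section \<open>Energies of the two methods\<close>

lemma triangle_area_pos:
  assumes "triangle_on e a b c"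
  shows "measure lebesgue e > 0"
proof -
  have "\<not> negligible e"
    using triangle_interior_nonempty[OF assms] triangle_compact_convex[OF assms]
    by (simp add: negligible_convex_interior)
  then show ?thesis
    using lmeasurable_compact[OF triangle_compact_convex(1)[OF assms]]
    by (simp add: negligible_iff_measure order_less_le)
qed

text \<open>At the two boundary points of the disc in the directions \<open>g\<close> and
  \<open>- g\<close> the linear function differs by \<open>2 * r * norm g\<close>.\<close>

lemma cball_inner_bound:
  fixes g :: "real^2"
  assumes "cball x r \<subseteq> e" "0 \<le> r"
    and bound: "\<And>y z. y \<in> e \<Longrightarrow> z \<in> e \<Longrightarrow> inner g y - inner g z \<le> B"
  shows "2 * r * norm g \<le> B"
proof (cases "g = 0")
  case True
  have "x \<in> e" using assms(1,2) by auto
  then show ?thesis using bound[of x x] True by simp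
next
  case False
  define d where "d = (r / norm g) *\<^sub>R g"
  have "norm d = r" using False \<open>0 \<le> r\<close> by (simp add: d_def)
  then have "x + d \<in> e" "x - d \<in> e" using assms(1) by (auto simp: dist_norm)
  then have "inner g (x + d) - inner g (x - d) \<le> B" using bound by blast
  then have "2 * inner g d \<le> B" by (simp add: inner_add_right inner_diff_right)
  also have "inner g d = r * norm g"
    using False by (simp add: d_def dot_square_norm power2_eq_square)
  finally show ?thesis by simp
qed

text \<open>A linear function takes its extremes over a triangle at vertices; the hull argument is
  applied first to \<open>y\<close>, then to \<open>z\<close>.\<close>

lemma triangle_inner_bound:
  assumes t: "triangle_on e a b c"
    and vertices: "\<And>p q. p \<in> {a, b, c} \<Longrightarrow> q \<in> {a, b, c} \<Longrightarrow> inner g p - inner g q \<le> B"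
    and "y \<in> e" "z \<in> e"
  shows "inner g y - inner g z \<le> B"
proof -
  have e: "e = convex hull {a, b, c}" using t by (simp add: triangle_on_def)
  have 1: "inner g y - inner g q \<le> B" if "q \<in> {a, b, c}" for q
  proof -
    have "convex hull {a, b, c} \<subseteq> {y. inner g y \<le> B + inner g q}"
      using vertices[OF _ that] by (intro hull_minimal convex_halfspace_le) fastforce
    then have "y \<in> {y. inner g y \<le> B + inner g q}" using \<open>y \<in> e\<close> e by blast
    then show ?thesis by simp
  qed
  have "convex hull {a, b, c} \<subseteq> {z. inner g z \<ge> inner g y - B}"
    using 1 by (intro hull_minimal convex_halfspace_ge) fastforce
  then have "z \<in> {z. inner g z \<ge> inner g y - B}" using \<open>z \<in> e\<close> e by blast
  then show ?thesis by simp
qed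

lemma inball_diameter_le:
  assumes "e \<noteq> {}" and "\<And>x r. 0 \<le> r \<Longrightarrow> cball x r \<subseteq> e \<Longrightarrow> 2 * r \<le> B"
  shows "inball_diameter e \<le> B"
  unfolding inball_diameter_def
proof (rule cSup_least)
  obtain x where "x \<in> e" using assms(1) by blast
  then have "cball x 0 \<subseteq> e" by simp
  then show "{2 * r |r. 0 \<le> r \<and> (\<exists>x. cball x r \<subseteq> e)} \<noteq> {}" by blast
qed (use assms(2) in auto)

text \<open>The difference of the two sides is the weighted variance of \<open>f\<close> about its
  mean \<open>m\<close>, which is nonnegative.\<close>

lemma weighted_mean_norm_le:
  fixes f :: "'a \<Rightarrow> 'b::real_inner"
  assumes "finite I" and "\<And>i. i \<in> I \<Longrightarrow> 0 \<le> w i" and "(\<Sum>i\<in>I. w i) > 0"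
  defines "m \<equiv> (1 / (\<Sum>i\<in>I. w i)) *\<^sub>R (\<Sum>i\<in>I. w i *\<^sub>R f i)"
  shows "(\<Sum>i\<in>I. w i) * (norm m)\<^sup>2 \<le> (\<Sum>i\<in>I. w i * (norm (f i))\<^sup>2)"
proof -
  let ?W = "\<Sum>i\<in>I. w i"
  have sum_eq: "(\<Sum>i\<in>I. w i *\<^sub>R f i) = ?W *\<^sub>R m" using assms(3) by (simp add: m_def)
  have "0 \<le> (\<Sum>i\<in>I. w i * (norm (f i - m))\<^sup>2)"
    using assms(2) by (intro sum_nonneg) auto
  also have "\<dots> = (\<Sum>i\<in>I. w i * (norm (f i))\<^sup>2 - 2 * inner m (w i *\<^sub>R f i) + w i * (norm m)\<^sup>2)"
    by (rule sum.cong)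
      (auto simp: power2_norm_eq_inner inner_diff_left inner_diff_right inner_commute algebra_simps)
  also have "\<dots> = (\<Sum>i\<in>I. w i * (norm (f i))\<^sup>2) - 2 * inner m (\<Sum>i\<in>I. w i *\<^sub>R f i)
      + ?W * (norm m)\<^sup>2"
    by (simp add: sum.distrib sum_subtractf inner_sum_right sum_distrib_left sum_distrib_right)
  also have "\<dots> = (\<Sum>i\<in>I. w i * (norm (f i))\<^sup>2) - ?W * (norm m)\<^sup>2"
    unfolding sum_eq by (simp add: power2_norm_eq_inner)
  finally show ?thesis by simp
qed

context conforming_mesh
begin

abbreviation slope :: "(real^2 \<Rightarrow> real) \<Rightarrow> (real^2) set \<Rightarrow> real^2" where
  "slope w e \<equiv> fst (interp_coeffs w e)"

lemma interior_element_subset: "e \<in> \<T> \<Longrightarrow> interior e \<subseteq> \<Omega>"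
  using interior_mono[of e "closure \<Omega>"] Union_mesh domain_eq by blast

lemma elem_grad_interp:
  assumes "e \<in> \<T>"
  shows "elem_grad (interp \<T> w) e = slope w e"
proof (rule elem_grad_eq)
  obtain a b c where "triangle_on e a b c" using element_triangle[OF assms] by blast
  then show "interior e \<noteq> {}" by (rule triangle_interior_nonempty)
  show "interp \<T> w x = inner (slope w e) x + snd (interp_coeffs w e)" if "x \<in> e" for x
    by (rule interp_on_element[OF assms that])
qed

lemma grad_interp:
  assumes "e \<in> \<T>" "x \<in> interior e"
  shows "grad (interp \<T> w) x = slope w e"
proof (rule grad_eq)
  have "((\<lambda>y. inner (slope w e) y + snd (interp_coeffs w e)) has_derivative (\<lambda>h. inner h (slope w e)))
      (at x)"
    by (auto intro!: derivative_eq_intros simp: inner_commute)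
  then have "(interp \<T> w has_derivative (\<lambda>h. inner h (slope w e))) (at x)"
  proof (rule has_derivative_transform_within_open[OF _ open_interior assms(2)])
    fix y assume "y \<in> interior e"
    then have "y \<in> e" using interior_subset by blast
    then show "inner (slope w e) y + snd (interp_coeffs w e) = interp \<T> w y"
      by (simp add: interp_on_element[OF assms(1)])
  qed
  then show "GDERIV (interp \<T> w) x :> slope w e" by (simp add: gderiv_def)
qed

lemma negligible_mesh_frontiers: "negligible (\<Union>e\<in>\<T>. frontier e)"
  using finite_mesh element_convex negligible_convex_frontier by (intro negligible_Union) auto

text \<open>Off the element boundaries a point of \<Omega> lies in the interior of exactly one
  element, where the gradient is the slope of that element.\<close>

lemma fem_integral:
  "(LINT x:\<Omega>|lebesgue. inner (grad (interp \<T> w) x) (grad (interp \<T> w') x)) =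
     (\<Sum>e\<in>\<T>. measure lebesgue e * inner (slope w e) (slope w' e))"
proof (rule set_integral_eq_sum_indicators[OF finite_mesh _ negligible_mesh_frontiers])
  show "e \<in> lmeasurable" if "e \<in> \<T>" for e
    by (rule lmeasurable_compact[OF element_compact[OF that]])
  fix x assume x: "x \<notin> (\<Union>e\<in>\<T>. frontier e)"
  have int: "x \<in> interior e" if "e \<in> \<T>" "x \<in> e" for e
    using x that closure_subset by (auto simp: frontier_def)
  show "indicator \<Omega> x * inner (grad (interp \<T> w) x) (grad (interp \<T> w') x) =
      (\<Sum>e\<in>\<T>. indicator e x * inner (slope w e) (slope w' e))"
  proof (cases "x \<in> \<Omega>")
    case True
    then obtain e where e: "e \<in> \<T>" "x \<in> e" using domain_subset by blast
    have "(\<Sum>e\<in>\<T>. indicator e x * inner (slope w e) (slope w' e)) =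
        (\<Sum>e'\<in>{e}. indicator e' x * inner (slope w e') (slope w' e'))"
      using interior_element_unique[OF e(1) _ int[OF e]] e(1) finite_mesh
      by (intro sum.mono_neutral_right) (auto simp: indicator_def)
    then show ?thesis using True e grad_interp[OF e(1) int[OF e]] by simp
  next
    case False
    then have "x \<notin> e" if "e \<in> \<T>" for e using int that interior_element_subset by blast
    then show ?thesis using False by simp
  qed
qed

text \<open>One incidence for each sub-triangle. The comparison of energies rests on grouping sums
  over incidences by element or by edge.\<close>

definition mesh_sides :: "((real^2) set \<times> (real^2) set) set" where
  "mesh_sides = (SIGMA e:\<T>. {l. l edge_of e})"

lemma finite_element_edges: "e \<in> \<T> \<Longrightarrow> finite {l. l edge_of e}"
  using element_triangle triangle_card_edges by metis

lemma finite_mesh_sides: "finite mesh_sides"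
  unfolding mesh_sides_def using finite_mesh finite_element_edges by blast

lemma finite_mesh_edges: "finite (mesh_edges \<T>)"
proof -
  have "mesh_edges \<T> = (\<Union>e\<in>\<T>. {l. l edge_of e})" by (auto simp: mesh_edges_def)
  then show ?thesis using finite_mesh finite_element_edges by simp
qed

lemma sum_mesh_sides_by_element:
  "(\<Sum>(e, l)\<in>mesh_sides. f e l) = (\<Sum>e\<in>\<T>. \<Sum>l | l edge_of e. f e l)"
  unfolding mesh_sides_def using finite_mesh finite_element_edges by (subst sum.Sigma) auto

lemma sum_mesh_sides_by_edge:
  "(\<Sum>(e, l)\<in>mesh_sides. f e l) = (\<Sum>l\<in>mesh_edges \<T>. \<Sum>e\<in>edge_elements \<T> l. f e l)"
proof -
  have "(\<Sum>l\<in>mesh_edges \<T>. \<Sum>e\<in>edge_elements \<T> l. f e l) =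
      (\<Sum>(l, e)\<in>(SIGMA l:mesh_edges \<T>. edge_elements \<T> l). f e l)"
    using finite_mesh_edges finite_mesh by (subst sum.Sigma) (auto simp: edge_elements_def)
  also have "\<dots> = (\<Sum>(e, l)\<in>mesh_sides. f e l)"
    by (rule sum.reindex_bij_witness[where i=prod.swap and j=prod.swap])
      (auto simp: mesh_sides_def mesh_edges_def edge_elements_def)
  finally show ?thesis ..
qed

text \<open>Off a null set a point of \<Omega> lies in exactly one sub-triangle, hence in one
  smoothing domain, and each sub-triangle has a third of the area of its element.\<close>

lemma es_integral:
  "(LINT x:\<Omega>|lebesgue. inner (es_grad \<T> u x) (es_grad \<T> v x)) =
     (\<Sum>(e, l)\<in>mesh_sides. measure lebesgue e / 3 * inner (edge_grad \<T> u l) (edge_grad \<T> v l))"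
proof -
  define N where "N = (\<Union>e\<in>\<T>. frontier e) \<union>
    (\<Union>e\<in>\<T>. \<Union>(l, l')\<in>{(l, l'). l edge_of e \<and> l' edge_of e \<and> l \<noteq> l'}.
      sub_triangle e l \<inter> sub_triangle e l')"
  have "negligible N"
    unfolding N_def
  proof (rule negligible_Un[OF negligible_mesh_frontiers], rule negligible_Union)
    show "finite ((\<lambda>e. \<Union>(l, l')\<in>{(l, l'). l edge_of e \<and> l' edge_of e \<and> l \<noteq> l'}.
      sub_triangle e l \<inter> sub_triangle e l') ` \<T>)" using finite_mesh by simp
    fix t assume "t \<in> (\<lambda>e. \<Union>(l, l')\<in>{(l, l'). l edge_of e \<and> l' edge_of e \<and> l \<noteq> l'}.
      sub_triangle e l \<inter> sub_triangle e l') ` \<T>"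
    then obtain e where e: "e \<in> \<T>"
      and t: "t = (\<Union>(l, l')\<in>{(l, l'). l edge_of e \<and> l' edge_of e \<and> l \<noteq> l'}.
        sub_triangle e l \<inter> sub_triangle e l')" by blast
    obtain a b c where tri: "triangle_on e a b c" using element_triangle[OF e] by blast
    have "finite ({l. l edge_of e} \<times> {l. l edge_of e})"
      using finite_element_edges[OF e] by simp
    then have "finite {(l, l'). l edge_of e \<and> l' edge_of e \<and> l \<noteq> l'}"
      by (rule rev_finite_subset) auto
    then show "negligible t"
      unfolding t using negligible_sub_triangle_Int[OF tri] by (intro negligible_Union) auto
  qed
  have "(LINT x:\<Omega>|lebesgue. inner (es_grad \<T> u x) (es_grad \<T> v x)) =
      (\<Sum>s\<in>mesh_sides. measure lebesgue (case s of (e, l) \<Rightarrow> sub_triangle e l) *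
        (case s of (e, l) \<Rightarrow> inner (edge_grad \<T> u l) (edge_grad \<T> v l)))"
  proof (rule set_integral_eq_sum_indicators[OF finite_mesh_sides _ \<open>negligible N\<close>])
    fix s assume "s \<in> mesh_sides"
    then obtain e l where s: "s = (e, l)" "e \<in> \<T>" "l edge_of e" by (auto simp: mesh_sides_def)
    obtain a b c where "triangle_on e a b c" using element_triangle[OF s(2)] by blast
    then show "(case s of (e, l) \<Rightarrow> sub_triangle e l) \<in> lmeasurable"
      using compact_sub_triangle[OF _ s(3)] s(1) by (auto intro: lmeasurable_compact)
  next
    fix x assume x: "x \<notin> N"
    have int: "x \<in> interior e" if "e \<in> \<T>" "x \<in> e" for e
      using x that closure_subset by (auto simp: frontier_def N_def)
    have sub: "sub_triangle e l \<subseteq> e" if "e \<in> \<T>" "l edge_of e" for e l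
      using element_triangle[OF that(1)] sub_triangle_subset that(2) by metis
    show "indicator \<Omega> x * inner (es_grad \<T> u x) (es_grad \<T> v x) =
        (\<Sum>s\<in>mesh_sides. indicator (case s of (e, l) \<Rightarrow> sub_triangle e l) x *
          (case s of (e, l) \<Rightarrow> inner (edge_grad \<T> u l) (edge_grad \<T> v l)))"
    proof (cases "x \<in> \<Omega>")
      case True
      then obtain e where e: "e \<in> \<T>" "x \<in> e" using domain_subset by blast
      obtain a b c where tri: "triangle_on e a b c" using element_triangle[OF e(1)] by blast
      obtain l where l: "l edge_of e" "x \<in> sub_triangle e l"
        using sub_triangle_cover[OF tri e(2)] by blast
      have unique: "e' = e \<and> l' = l" if "e' \<in> \<T>" "l' edge_of e'" "x \<in> sub_triangle e' l'" for e' l'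
      proof -
        have "x \<in> e'" using sub that by blast
        then have "e' = e" using interior_element_unique[OF e(1) that(1) int[OF e]] by simp
        moreover have "l' = l"
        proof (rule ccontr)
          assume "l' \<noteq> l"
          then have "x \<in> N" using e(1) l that \<open>e' = e\<close> unfolding N_def by blast
          then show False using x by simp
        qed
        ultimately show ?thesis by simp
      qed
      \<comment> \<open>Lying in the smoothing domain of \<open>l'\<close> means lying in some
        sub-triangle with edge \<open>l'\<close>, so by \<open>unique\<close> only the summand for
        \<open>l\<close> survives.\<close>
      have es: "es_grad \<T> u x = edge_grad \<T> u l" for u
      proof -
        have "smoothing_domain \<T> l' = (\<Union>e\<in>edge_elements \<T> l'. sub_triangle e l')" for l'
          by (simp add: smoothing_domain_def sub_triangle_def)
        then have "x \<in> smoothing_domain \<T> l' \<longleftrightarrow> l' = l" for l'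
          using unique e(1) l unfolding edge_elements_def by blast
        then have "es_grad \<T> u x = (\<Sum>l'\<in>mesh_edges \<T>. if l' = l then edge_grad \<T> u l' else 0)"
          unfolding es_grad_def by (intro sum.cong) (auto simp: indicator_def)
        moreover have "l \<in> mesh_edges \<T>" using e(1) l(1) by (auto simp: mesh_edges_def)
        ultimately show ?thesis using finite_mesh_edges by simp
      qed
      have "(e, l) \<in> mesh_sides" using e l by (simp add: mesh_sides_def)
      then have "(\<Sum>s\<in>mesh_sides. indicator (case s of (e, l) \<Rightarrow> sub_triangle e l) x *
          (case s of (e, l) \<Rightarrow> inner (edge_grad \<T> u l) (edge_grad \<T> v l))) =
        (\<Sum>s\<in>{(e, l)}. indicator (case s of (e, l) \<Rightarrow> sub_triangle e l) x *
          (case s of (e, l) \<Rightarrow> inner (edge_grad \<T> u l) (edge_grad \<T> v l)))"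
        using finite_mesh_sides unique
        by (intro sum.mono_neutral_right) (auto simp: mesh_sides_def indicator_def)
      then show ?thesis using True l by (simp add: es)
    next
      case False
      then have "x \<notin> e" if "e \<in> \<T>" for e using int that interior_element_subset by blast
      then have "x \<notin> sub_triangle e l" if "(e, l) \<in> mesh_sides" for e l
        using that sub by (auto simp: mesh_sides_def)
      then have "(\<Sum>s\<in>mesh_sides. indicator (case s of (e, l) \<Rightarrow> sub_triangle e l) x *
          (case s of (e, l) \<Rightarrow> inner (edge_grad \<T> u l) (edge_grad \<T> v l))) = 0"
        by (intro sum.neutral) auto
      then show ?thesis using False by simp
    qed
  qed
  also have "\<dots> = (\<Sum>(e, l)\<in>mesh_sides. measure lebesgue e / 3 *
      inner (edge_grad \<T> u l) (edge_grad \<T> v l))"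
  proof (rule sum.cong[OF refl])
    fix s assume "s \<in> mesh_sides"
    then obtain e l where s: "s = (e, l)" "e \<in> \<T>" "l edge_of e" by (auto simp: mesh_sides_def)
    obtain a b c where "triangle_on e a b c" using element_triangle[OF s(2)] by blast
    then show "measure lebesgue (case s of (e, l) \<Rightarrow> sub_triangle e l) *
        (case s of (e, l) \<Rightarrow> inner (edge_grad \<T> u l) (edge_grad \<T> v l)) =
      (case s of (e, l) \<Rightarrow> measure lebesgue e / 3 * inner (edge_grad \<T> u l) (edge_grad \<T> v l))"
      using measure_sub_triangle s(1,3) by auto
  qed
  finally show ?thesis .
qed

section \<open>The two energies and their comparison\<close>

definition energy :: "(real^2 \<Rightarrow> real) \<Rightarrow> real" where
  "energy w = (\<Sum>e\<in>\<T>. measure lebesgue e * (norm (slope w e))\<^sup>2)"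

definition smoothed_energy :: "(real^2 \<Rightarrow> real) \<Rightarrow> real" where
  "smoothed_energy w =
     (\<Sum>(e, l)\<in>mesh_sides. measure lebesgue e / 3 * (norm (edge_grad \<T> (interp \<T> w) l))\<^sup>2)"

lemma element_area_pos: "e \<in> \<T> \<Longrightarrow> measure lebesgue e > 0"
  using element_triangle triangle_area_pos by metis

lemma edge_area_pos:
  assumes "l \<in> mesh_edges \<T>"
  shows "(\<Sum>e\<in>edge_elements \<T> l. measure lebesgue e) > 0"
  using assms finite_mesh element_area_pos
  by (intro sum_pos) (auto simp: edge_elements_def mesh_edges_def)

lemma edge_grad_interp:
  "edge_grad \<T> (interp \<T> w) l = (1 / (\<Sum>e\<in>edge_elements \<T> l. measure lebesgue e)) *\<^sub>R
     (\<Sum>e\<in>edge_elements \<T> l. measure lebesgue e *\<^sub>R slope w e)"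
  unfolding edge_grad_def
  by (intro arg_cong2[where f=scaleR] sum.cong refl) (auto simp: edge_elements_def elem_grad_interp)

text \<open>On each edge the variance inequality bounds the squared norm of the mean. Regrouped by
  element, the weight \<open>measure lebesgue e / 3\<close> occurs once for each of the three
  edges.\<close>

lemma smoothed_energy_le: "smoothed_energy w \<le> energy w"
proof -
  have "smoothed_energy w = (\<Sum>l\<in>mesh_edges \<T>. (\<Sum>e\<in>edge_elements \<T> l. measure lebesgue e) *
      (norm (edge_grad \<T> (interp \<T> w) l))\<^sup>2 / 3)"
    unfolding smoothed_energy_def sum_mesh_sides_by_edge
    by (simp add: sum_distrib_right sum_divide_distrib)
  also have "\<dots> \<le> (\<Sum>l\<in>mesh_edges \<T>. \<Sum>e\<in>edge_elements \<T> l. measure lebesgue e / 3 * (norm (slope w e))\<^sup>2)"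
  proof (rule sum_mono)
    fix l assume "l \<in> mesh_edges \<T>"
    then have "(\<Sum>e\<in>edge_elements \<T> l. measure lebesgue e) * (norm (edge_grad \<T> (interp \<T> w) l))\<^sup>2
        \<le> (\<Sum>e\<in>edge_elements \<T> l. measure lebesgue e * (norm (slope w e))\<^sup>2)"
      unfolding edge_grad_interp using finite_mesh edge_area_pos
      by (intro weighted_mean_norm_le) (auto simp: edge_elements_def)
    then show "(\<Sum>e\<in>edge_elements \<T> l. measure lebesgue e) * (norm (edge_grad \<T> (interp \<T> w) l))\<^sup>2 / 3
        \<le> (\<Sum>e\<in>edge_elements \<T> l. measure lebesgue e / 3 * (norm (slope w e))\<^sup>2)"
      by (simp add: sum_divide_distrib[symmetric])
  qed
  also have "\<dots> = (\<Sum>e\<in>\<T>. \<Sum>l | l edge_of e. measure lebesgue e / 3 * (norm (slope w e))\<^sup>2)"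
    by (rule trans[OF sum_mesh_sides_by_edge[symmetric] sum_mesh_sides_by_element])
  also have "\<dots> = energy w"
    unfolding energy_def
  proof (rule sum.cong[OF refl])
    fix e assume "e \<in> \<T>"
    then obtain a b c where "triangle_on e a b c" using element_triangle by blast
    then have "card {l. l edge_of e} = 3" by (rule triangle_card_edges(2))
    then show "(\<Sum>l | l edge_of e. measure lebesgue e / 3 * (norm (slope w e))\<^sup>2) =
        measure lebesgue e * (norm (slope w e))\<^sup>2" by simp
  qed
  finally show ?thesis .
qed

text \<open>
  Averaging over the elements sharing an edge does not change the derivative along that edge,
  since the interpolant is continuous across it.
\<close>

lemma edge_grad_tangential:
  assumes "l \<in> mesh_edges \<T>" "p \<in> l" "q \<in> l"
  shows "inner (edge_grad \<T> (interp \<T> w) l) (p - q) = interp \<T> w p - interp \<T> w q"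
proof -
  let ?A = "\<Sum>e\<in>edge_elements \<T> l. measure lebesgue e"
  have tang: "inner (slope w e) (p - q) = interp \<T> w p - interp \<T> w q" if "e \<in> edge_elements \<T> l" for e
  proof -
    have "e \<in> \<T>" "p \<in> e" "q \<in> e"
      using that assms edge_of_imp_subset by (auto simp: edge_elements_def)
    then show ?thesis using interp_on_element by (simp add: inner_diff_right)
  qed
  have "inner (edge_grad \<T> (interp \<T> w) l) (p - q) =
      (1 / ?A) * (\<Sum>e\<in>edge_elements \<T> l. measure lebesgue e * inner (slope w e) (p - q))"
    by (simp add: edge_grad_interp inner_sum_left)
  also have "\<dots> = (1 / ?A) * (?A * (interp \<T> w p - interp \<T> w q))"
    by (simp add: tang sum_distrib_right)
  also have "\<dots> = interp \<T> w p - interp \<T> w q"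
    using edge_area_pos[OF assms(1)] by simp
  finally show ?thesis .
qed

lemma slope_le_edge_grads:
  assumes "e \<in> \<T>" and shape: "diameter e \<le> \<sigma> * inball_diameter e" and "\<sigma> > 0"
  shows "(norm (slope w e))\<^sup>2 \<le> \<sigma>\<^sup>2 * (\<Sum>l | l edge_of e. (norm (edge_grad \<T> (interp \<T> w) l))\<^sup>2)"
proof (cases "slope w e = 0")
  case True
  then show ?thesis by (simp add: sum_nonneg)
next
  case False
  obtain a b c where t: "triangle_on e a b c" using element_triangle[OF assms(1)] by blast
  have bounded: "bounded e" using triangle_compact_convex(1)[OF t] compact_imp_bounded by blast
  \<comment> \<open>This root bounds each of the three edge means, and its square is the sum in the
    claim.\<close>
  define B where "B = sqrt (\<Sum>l | l edge_of e. (norm (edge_grad \<T> (interp \<T> w) l))\<^sup>2)"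
  have "B \<ge> 0" by (simp add: B_def sum_nonneg)
  have edge_le: "norm (edge_grad \<T> (interp \<T> w) l) \<le> B" if "l edge_of e" for l
    unfolding B_def using finite_element_edges[OF assms(1)] that
    by (intro real_le_rsqrt member_le_sum) auto
  have D: "0 < diameter e"
  proof -
    have "dist a b \<le> diameter e"
      using triangle_vertices_in[OF t] by (intro diameter_bounded_bound bounded)
    moreover have "dist a b > 0" using t by (simp add: triangle_on_def)
    ultimately show ?thesis by linarith
  qed
  have vertices: "inner (slope w e) p - inner (slope w e) q \<le> B * diameter e"
    if "p \<in> {a, b, c}" "q \<in> {a, b, c}" for p q
  proof (cases "p = q")
    case True
    then show ?thesis using \<open>B \<ge> 0\<close> D by simp
  next
    case False
    define l where "l = convex hull {p, q}"
    have "l \<in> {convex hull {b, c}, convex hull {a, c}, convex hull {a, b}}"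
      using that False by (auto simp: l_def insert_commute)
    then have l: "l edge_of e" using triangle_edge_iff[OF t] by blast
    have pq: "p \<in> l" "q \<in> l" by (auto simp: l_def intro: hull_inc)
    then have "p \<in> e" "q \<in> e" using edge_of_imp_subset[OF l] by auto
    have "inner (slope w e) p - inner (slope w e) q = interp \<T> w p - interp \<T> w q"
      using interp_on_element[OF assms(1)] \<open>p \<in> e\<close> \<open>q \<in> e\<close> by simp
    also have "\<dots> = inner (edge_grad \<T> (interp \<T> w) l) (p - q)"
    proof -
      have "l \<in> mesh_edges \<T>" using l assms(1) by (auto simp: mesh_edges_def)
      then show ?thesis using edge_grad_tangential[OF _ pq] by simp
    qed
    also have "\<dots> \<le> norm (edge_grad \<T> (interp \<T> w) l) * norm (p - q)"
      by (rule norm_cauchy_schwarz)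
    also have "\<dots> \<le> B * diameter e"
      using edge_le[OF l] \<open>B \<ge> 0\<close> diameter_bounded_bound[OF bounded \<open>p \<in> e\<close> \<open>q \<in> e\<close>]
      by (intro mult_mono) (auto simp: dist_norm)
    finally show ?thesis .
  qed
  \<comment> \<open>The affine function oscillates by at most \<open>B * diameter e\<close> between
    vertices, hence on all of \<open>e\<close>, but by \<open>2 * r * norm (slope w e)\<close> on an
    inscribed disc of radius \<open>r\<close>.\<close>
  have "inball_diameter e \<le> B * diameter e / norm (slope w e)"
  proof (rule inball_diameter_le)
    show "e \<noteq> {}" using triangle_vertices_in[OF t] by blast
    fix x r assume "0 \<le> (r::real)" "cball x r \<subseteq> e"
    then have "2 * r * norm (slope w e) \<le> B * diameter e"
      using cball_inner_bound triangle_inner_bound[OF t vertices] by metis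
    then show "2 * r \<le> B * diameter e / norm (slope w e)"
      using False by (simp add: pos_le_divide_eq)
  qed
  then have "\<sigma> * inball_diameter e \<le> \<sigma> * (B * diameter e / norm (slope w e))"
    using \<open>\<sigma> > 0\<close> by (intro mult_left_mono) auto
  then have "diameter e \<le> \<sigma> * (B * diameter e / norm (slope w e))"
    using shape by linarith
  then have "norm (slope w e) * diameter e \<le> (\<sigma> * B) * diameter e"
    using False by (simp add: divide_simps mult_ac)
  then have "norm (slope w e) \<le> \<sigma> * B"
    using mult_le_cancel_right_pos[OF D] by blast
  then have "(norm (slope w e))\<^sup>2 \<le> (\<sigma> * B)\<^sup>2" by (intro power_mono) auto
  also have "\<dots> = \<sigma>\<^sup>2 * (\<Sum>l | l edge_of e. (norm (edge_grad \<T> (interp \<T> w) l))\<^sup>2)"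
    by (simp add: power_mult_distrib B_def sum_nonneg)
  finally show ?thesis .
qed

text \<open>Summation of the bound on single elements; the factor 3 makes up for the weight
  \<open>measure lebesgue e / 3\<close> of an incidence.\<close>

lemma energy_le:
  assumes "\<And>e. e \<in> \<T> \<Longrightarrow> diameter e \<le> \<sigma> * inball_diameter e" and "\<sigma> > 0"
  shows "energy w \<le> 3 * \<sigma>\<^sup>2 * smoothed_energy w"
proof -
  have "energy w \<le> (\<Sum>e\<in>\<T>. measure lebesgue e *
      (\<sigma>\<^sup>2 * (\<Sum>l | l edge_of e. (norm (edge_grad \<T> (interp \<T> w) l))\<^sup>2)))"
    unfolding energy_def using slope_le_edge_grads assms
    by (intro sum_mono mult_left_mono) auto
  also have "\<dots> = 3 * \<sigma>\<^sup>2 * smoothed_energy w"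
    unfolding smoothed_energy_def sum_mesh_sides_by_element
    by (simp add: sum_distrib_left mult_ac)
  finally show ?thesis .
qed

text \<open>With all slopes zero the interpolant is continuous with finitely many values on a
  connected set, hence constant; its value at a boundary point is 0.\<close>

lemma energy_zero_imp_interp_zero:
  assumes w: "\<And>p. p \<notin> \<Omega> \<Longrightarrow> w p = 0" and "energy w = 0" and "x \<in> \<Omega>"
  shows "interp \<T> w x = 0"
proof -
  have slope: "slope w e = 0" if "e \<in> \<T>" for e
  proof -
    have "\<forall>e\<in>\<T>. measure lebesgue e * (norm (slope w e))\<^sup>2 = 0"
      using \<open>energy w = 0\<close> finite_mesh unfolding energy_def
      by (subst (asm) sum_nonneg_eq_0_iff) auto
    then show ?thesis using element_area_pos[OF that] that by force
  qed
  have "interp \<T> w ` closure \<Omega> \<subseteq> (\<lambda>e. snd (interp_coeffs w e)) ` \<T>"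
    using interp_on_element slope by (fastforce simp flip: Union_mesh)
  then have "finite (interp \<T> w ` closure \<Omega>)" using finite_mesh finite_subset by blast
  then have "interp \<T> w constant_on closure \<Omega>"
    by (intro continuous_finite_range_constant continuous_on_interp
        connected_imp_connected_closure connected_domain)
  then obtain k where k: "\<And>x. x \<in> closure \<Omega> \<Longrightarrow> interp \<T> w x = k" by (auto simp: constant_on_def)
  \<comment> \<open>A nonempty bounded set is neither empty nor the whole plane, so it has a
    frontier point, which an open set does not contain.\<close>
  have "\<Omega> \<noteq> UNIV" using bounded_domain not_bounded_UNIV by metis
  then obtain y where "y \<in> frontier \<Omega>" using frontier_eq_empty domain_nonempty by blast
  then have "y \<in> closure \<Omega>" "y \<notin> \<Omega>"
    using open_domain by (auto simp: frontier_def interior_open)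
  then have "k = 0" using k interp_zero_outside[of w y] w by simp
  then show ?thesis using k \<open>x \<in> \<Omega>\<close> closure_subset by blast
qed

end

section \<open>Stiffness matrices\<close>

text \<open>At unit vectors the bilinear form returns the matrix entries.\<close>

lemma symmetric_of_form:
  fixes A :: "real mat"
  assumes A: "A \<in> carrier_mat n n"
    and form: "\<And>x y. x \<in> carrier_vec n \<Longrightarrow> y \<in> carrier_vec n \<Longrightarrow>
      scalar_prod x (A *\<^sub>v y) = scalar_prod y (A *\<^sub>v x)"
  shows "transpose_mat A = A"
proof (rule eq_matI)
  have entry: "scalar_prod (unit_vec n i) (A *\<^sub>v unit_vec n j) = A $$ (i, j)"
    if "i < n" "j < n" for i j
    using A that by (simp add: scalar_prod_left_unit[of _ n])
  fix i j assume "i < dim_row A" "j < dim_col A"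
  then show "transpose_mat A $$ (i, j) = A $$ (i, j)"
    using entry[of i j] entry[of j i] form[of "unit_vec n i" "unit_vec n j"] A by simp
qed (use A in auto)

text \<open>Extends the vector of nodal values to the plane by zero, which is the shape of data that
  \<open>interp\<close> expects. For a distinct numbering at most one summand is nonzero.\<close>

definition nodal :: "(real^2) list \<Rightarrow> real Matrix.vec \<Rightarrow> real^2 \<Rightarrow> real" where
  "nodal xs v p = (\<Sum>i<length xs. if xs ! i = p then vec_index v i else 0)"

context conforming_mesh
begin

lemma nodal_zero_outside:
  assumes "node_numbering \<Omega> \<T> xs" "p \<notin> \<Omega>"
  shows "nodal xs v p = 0"
  unfolding nodal_def
proof (rule sum.neutral, intro ballI)
  fix i assume "i \<in> {..<length xs}"
  then have "xs ! i \<in> \<Omega>" using assms(1) nth_mem[of i xs] by (auto simp: node_numbering_def)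
  then show "(if xs ! i = p then vec_index v i else 0) = 0" using assms(2) by auto
qed

lemma dofs_interp_nodal:
  assumes xs: "node_numbering \<Omega> \<T> xs" and v: "v \<in> carrier_vec (length xs)"
  shows "dofs xs (interp \<T> (nodal xs v)) = v"
proof (rule eq_vecI)
  show "dim_vec (dofs xs (interp \<T> (nodal xs v))) = dim_vec v" using v by (simp add: dofs_def)
  fix i assume "i < dim_vec v"
  then have i: "i < length xs" using v by simp
  then have "xs ! i \<in> set xs" by simp
  then obtain e where "e \<in> \<T>" "xs ! i extreme_point_of e"
    using xs by (auto simp: node_numbering_def)
  then have "interp \<T> (nodal xs v) (xs ! i) = nodal xs v (xs ! i)" by (rule interp_vertex)
  also have "\<dots> = (\<Sum>j<length xs. if j = i then vec_index v j else 0)"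
    unfolding nodal_def using xs i
    by (intro sum.cong) (auto simp: node_numbering_def nth_eq_iff_index_eq)
  also have "\<dots> = vec_index v i" using i by simp
  finally show "vec_index (dofs xs (interp \<T> (nodal xs v))) i = vec_index v i"
    using i by (simp add: dofs_def vec_of_list_index)
qed

lemma nodal_in_V_h: "node_numbering \<Omega> \<T> xs \<Longrightarrow> interp \<T> (nodal xs v) \<in> V_h \<Omega> \<T>"
  using nodal_zero_outside by (intro interp_in_V_h) auto

text \<open>Every vector consists of the nodal values of an interpolant in \<open>V_h\<close>, so
  the defining identity fixes the bilinear form on all vectors.\<close>

lemma fem_stiffness_form:
  assumes xs: "node_numbering \<Omega> \<T> xs" and K: "fem_stiffness \<Omega> \<T> xs K"
    and "u \<in> carrier_vec (length xs)" "v \<in> carrier_vec (length xs)"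
  shows "scalar_prod u (K *\<^sub>v v) =
    (\<Sum>e\<in>\<T>. measure lebesgue e * inner (slope (nodal xs u) e) (slope (nodal xs v) e))"
  using K nodal_in_V_h[OF xs, of u] nodal_in_V_h[OF xs, of v]
    dofs_interp_nodal[OF xs assms(3)] dofs_interp_nodal[OF xs assms(4)] fem_integral
  unfolding fem_stiffness_def by metis

lemma es_stiffness_form:
  assumes xs: "node_numbering \<Omega> \<T> xs" and K: "es_stiffness \<Omega> \<T> xs K"
    and "u \<in> carrier_vec (length xs)" "v \<in> carrier_vec (length xs)"
  shows "scalar_prod u (K *\<^sub>v v) =
    (\<Sum>(e, l)\<in>mesh_sides. measure lebesgue e / 3 *
      inner (edge_grad \<T> (interp \<T> (nodal xs u)) l) (edge_grad \<T> (interp \<T> (nodal xs v)) l))"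
  using K nodal_in_V_h[OF xs, of u] nodal_in_V_h[OF xs, of v]
    dofs_interp_nodal[OF xs assms(3)] dofs_interp_nodal[OF xs assms(4)] es_integral
  unfolding es_stiffness_def by metis

lemma fem_stiffness_symmetric:
  assumes xs: "node_numbering \<Omega> \<T> xs" and K: "fem_stiffness \<Omega> \<T> xs K"
  shows "transpose_mat K = K"
proof (rule symmetric_of_form)
  show "K \<in> carrier_mat (length xs) (length xs)" using K by (simp add: fem_stiffness_def)
qed (simp add: fem_stiffness_form[OF xs K] inner_commute)

lemma es_stiffness_symmetric:
  assumes xs: "node_numbering \<Omega> \<T> xs" and K: "es_stiffness \<Omega> \<T> xs K"
  shows "transpose_mat K = K"
proof (rule symmetric_of_form)
  show "K \<in> carrier_mat (length xs) (length xs)" using K by (simp add: es_stiffness_def)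
qed (simp add: es_stiffness_form[OF xs K] inner_commute)

lemma fem_quad_form:
  assumes "node_numbering \<Omega> \<T> xs" "fem_stiffness \<Omega> \<T> xs K" "v \<in> carrier_vec (length xs)"
  shows "quad_form K v = energy (nodal xs v)"
  using fem_stiffness_form[OF assms(1,2,3,3)]
  by (simp add: quad_form_def energy_def power2_norm_eq_inner)

lemma es_quad_form:
  assumes "node_numbering \<Omega> \<T> xs" "es_stiffness \<Omega> \<T> xs K" "v \<in> carrier_vec (length xs)"
  shows "quad_form K v = smoothed_energy (nodal xs v)"
  using es_stiffness_form[OF assms(1,2,3,3)]
  by (simp add: quad_form_def smoothed_energy_def power2_norm_eq_inner)

text \<open>Zero energy forces the interpolant to vanish in \<Omega>, in particular at the nodes,
  where its values are the entries of \<open>v\<close>.\<close>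

lemma fem_quad_form_pos:
  assumes xs: "node_numbering \<Omega> \<T> xs" and K: "fem_stiffness \<Omega> \<T> xs K"
    and v: "v \<in> carrier_vec (length xs)" "v \<noteq> 0\<^sub>v (length xs)"
  shows "quad_form K v > 0"
proof -
  have "energy (nodal xs v) \<ge> 0" by (simp add: energy_def sum_nonneg)
  moreover have "energy (nodal xs v) \<noteq> 0"
  proof
    assume zero: "energy (nodal xs v) = 0"
    have "v = 0\<^sub>v (length xs)"
    proof (rule eq_vecI)
      fix i assume "i < dim_vec (0\<^sub>v (length xs) :: real Matrix.vec)"
      then have i: "i < length xs" by simp
      then have "xs ! i \<in> \<Omega>" using xs nth_mem[of i xs] by (auto simp: node_numbering_def)
      then have "interp \<T> (nodal xs v) (xs ! i) = 0"
        using energy_zero_imp_interp_zero[of "nodal xs v"] nodal_zero_outside[OF xs] zero by blast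
      moreover have "vec_index (dofs xs (interp \<T> (nodal xs v))) i = interp \<T> (nodal xs v) (xs ! i)"
        using i by (simp add: dofs_def vec_of_list_index)
      ultimately show "vec_index v i = vec_index (0\<^sub>v (length xs)) i"
        using dofs_interp_nodal[OF xs v(1)] i by simp
    qed (use v in simp)
    then show False using v(2) by simp
  qed
  ultimately show ?thesis using fem_quad_form[OF xs K v(1)] by simp
qed

lemma cond_number_es_le:
  assumes xs: "node_numbering \<Omega> \<T> xs" "xs \<noteq> []"
    and K: "fem_stiffness \<Omega> \<T> xs K" and K_ES: "es_stiffness \<Omega> \<T> xs K_ES"
    and M: "spd_mat (length xs) M" "M_inv \<in> carrier_mat (length xs) (length xs)" "inverts_mat M M_inv"
    and shape: "\<And>e. e \<in> \<T> \<Longrightarrow> diameter e \<le> \<sigma> * inball_diameter e" and "\<sigma> > 0"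
  shows "cond_number (M_inv * K_ES) \<le> 3 * \<sigma>\<^sup>2 * cond_number (M_inv * K)"
proof -
  have "cond_number (M_inv * K_ES) \<le> 3 * \<sigma>\<^sup>2 * 1 * cond_number (M_inv * K)"
  proof (rule cond_number_le_of_equivalent[where n="length xs"])
    show "K \<in> carrier_mat (length xs) (length xs)" using K by (simp add: fem_stiffness_def)
    show "K_ES \<in> carrier_mat (length xs) (length xs)" using K_ES by (simp add: es_stiffness_def)
    fix v :: "real Matrix.vec" assume v: "v \<in> carrier_vec (length xs)"
    show "quad_form K_ES v \<le> 1 * quad_form K v"
      using smoothed_energy_le fem_quad_form[OF xs(1) K v] es_quad_form[OF xs(1) K_ES v] by simp
    show "quad_form K v \<le> 3 * \<sigma>\<^sup>2 * quad_form K_ES v"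
      using energy_le[OF shape \<open>\<sigma> > 0\<close>] fem_quad_form[OF xs(1) K v] es_quad_form[OF xs(1) K_ES v]
      by simp
  qed (use fem_stiffness_symmetric[OF xs(1) K] es_stiffness_symmetric[OF xs(1) K_ES] M xs(2)
      fem_quad_form_pos[OF xs(1) K] \<open>\<sigma> > 0\<close> in auto)
  then show ?thesis by simp
qed

end

theorem corollary3p3:
  fixes \<Omega> :: "(real^2) set" and H :: "real set" and \<T> :: "real \<Rightarrow> (real^2) set set"
  assumes "polygonal_domain \<Omega>"
    and "H \<subseteq> {0<..}"
    and "\<And>h. h \<in> H \<Longrightarrow> mesh_of \<Omega> (\<T> h)"
    and "quasi_uniform H \<T>"
  shows "\<exists>C>0. \<forall>h\<in>H. \<forall>xs K K_ES M M_inv.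
           node_numbering \<Omega> (\<T> h) xs \<and> xs \<noteq> [] \<and>
           fem_stiffness \<Omega> (\<T> h) xs K \<and> es_stiffness \<Omega> (\<T> h) xs K_ES \<and>
           spd_mat (length xs) M \<and>
           M_inv \<in> carrier_mat (length xs) (length xs) \<and> inverts_mat M M_inv \<longrightarrow>
           cond_number (M_inv * K_ES) \<le> C * cond_number (M_inv * K)"
proof -
  obtain \<sigma> where \<sigma>: "\<sigma> > 0" "\<And>h e. h \<in> H \<Longrightarrow> e \<in> \<T> h \<Longrightarrow> diameter e \<le> \<sigma> * inball_diameter e"
    using assms(4) unfolding quasi_uniform_def by blast
  show ?thesis
  \<comment> \<open>The constant depends only on the shape-regularity bound \<sigma>, which is
    common to all meshes of the family.\<close>
  proof (intro exI[of _ "3 * \<sigma>\<^sup>2"] conjI ballI allI impI, goal_cases)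
    case 1
    then show ?case using \<sigma>(1) by simp
  next
    case (2 h xs K K_ES M M_inv)
    interpret conforming_mesh \<Omega> "\<T> h"
      by unfold_locales (use assms(1,3) 2(1) in auto)
    show ?case using cond_number_es_le \<sigma>(2)[OF 2(1)] \<sigma>(1) 2(2) by blast
  qed
qed

end
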